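(* Let $E$ be a uniformly convex real Banach space whose norm is uniformly Gâteaux differentiable, $A \subset E\times E^*$ a maximal monotone operator, $\{\alpha_n \}$ a sequence in $(0,1]$, and $\{r_n\}$ a sequence of positive real numbers. Suppose that $A^{-1}0$ is nonempty, $\alpha_n \to 0$, $\sum_{n=1}^\infty \alpha_n = \infty$, and $\inf_n r_n > 0$. Let $u$ be a point in $E$ and $\{x_n\}$ a sequence defined by $x_1 \in E$ and $$x_{n+1} = J^{-1} \bigl(\alpha_n J u + (1 - \alpha_n) J L_{r_n} x_n \bigr)$$ for $n\in \mathbb{N}$, where $L_{r_n} = (J+ r_n A)^{-1}J$. Then $\{ x_n \}$ converges strongly to $Q_{A^{-1}0}(u)$.
   Context: $E^*$ is the dual of $E$, $\langle x, x^*\rangle$ is the value of $x^*\in E^*$ at $x\in E$, and $\mathbb{N}$ is the set of positive integers. The norm of $E$ is uniformly Gâteaux differentiable if, with $S_E=\{x\in E:\|x\|=1\}$, for each $y\in S_E$ the limit $\lim_{t\to0}(\|x+ty\|-\|x\|)/t$ is attained uniformly for $x\in S_E$. The (normalized) duality mapping $J$ of $E$ is $Jx=\{x^*\in E^*: \langle x,x^*\rangle=\|x\|^2=\|x^*\|^2\}$; when $E$ is smooth, strictly convex and reflexive (as is the case here) $J$ is a single-valued bijection of $E$ onto $E^*$, and $J^{-1}$ is its inverse. Define $\phi(x,y)=\|x\|^2-2\langle x,Jy\rangle+\|y\|^2$ for $x,y\in E$. For a nonempty closed convex subset $D$ of $E$ and $x\in E$, $Q_D(x)$ denotes the unique point $x_0\in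 D$ with $\phi(x_0,x)=\min\{\phi(y,x): y\in D\}$. A set-valued mapping $A\subset E\times E^*$ (identified with its graph) is a monotone operator if $\langle x-y,x^*-y^*\rangle\ge0$ for all $(x,x^* ),(y,y^* )\in A$; it is maximal if $A=A'$ whenever $A'\subset E\times E^*$ is a monotone operator with $A\subset A'$. $A^{-1}0=\{x\in E: Ax\ni0\}$, which is closed and convex when $A$ is maximal monotone. For $r>0$, the range of $J+rA$ is $E^*$ and the resolvent $L_r=(J+rA)^{-1}J$ is a well-defined single-valued mapping of $E$ onto $\{x\in E: Ax\neq\emptyset\}$. *)

theory Defs
  imports "HOL-Analysis.Analysis"
begin

text \<open>
  The dual \<open>E\<^sup>*\<close> of a real Banach space is the type of bounded linear functionals with the
  operator norm; set-valued mappings are identified with their graphs.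
\<close>

type_synonym 'a dual = "'a \<Rightarrow>\<^sub>L real"

definition uniformly_convex_space :: "'a::real_normed_vector itself \<Rightarrow> bool" where
  "uniformly_convex_space _ \<longleftrightarrow>
     (\<forall>\<epsilon>::real. 0 < \<epsilon> \<and> \<epsilon> \<le> 2 \<longrightarrow>
       (\<exists>\<delta>>0. \<forall>x\<in>sphere (0::'a) 1. \<forall>y\<in>sphere 0 1.
          norm (x - y) \<ge> \<epsilon> \<longrightarrow> norm ((1/2) *\<^sub>R (x + y)) \<le> 1 - \<delta>))"

definition uniformly_gateaux_differentiable_norm :: "'a::real_normed_vector itself \<Rightarrow> bool" where
  "uniformly_gateaux_differentiable_norm _ \<longleftrightarrow>
     (\<forall>y\<in>sphere (0::'a) 1. \<exists>l. uniform_limit (sphere 0 1)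
        (\<lambda>(t::real) x. (norm (x + t *\<^sub>R y) - norm x) / t) l (at 0))"

definition duality_mapping :: "('a::real_normed_vector \<times> 'a dual) set" where
  "duality_mapping = {(x, f). blinfun_apply f x = (norm x)\<^sup>2 \<and> (norm x)\<^sup>2 = (norm f)\<^sup>2}"

text \<open>
  The mapping \<open>J\<close> as a function; meaningful where the duality mapping is single-valued, in
  particular on every smooth space. Its inverse is \<open>inv J\<close>.
\<close>

definition J :: "'a::real_normed_vector \<Rightarrow> 'a dual" where
  "J x = (THE f. (x, f) \<in> duality_mapping)"

definition phi :: "'a::real_normed_vector \<Rightarrow> 'a \<Rightarrow> real" where
  "phi x y = (norm x)\<^sup>2 - 2 * blinfun_apply (J y) x + (norm y)\<^sup>2"

definition Q :: "'a::real_normed_vector set \<Rightarrow> 'a \<Rightarrow> 'a" where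
  "Q D x = (THE x0. x0 \<in> D \<and> (\<forall>y\<in>D. phi x0 x \<le> phi y x))"

definition monotone_operator :: "('a::real_normed_vector \<times> 'a dual) set \<Rightarrow> bool" where
  "monotone_operator A \<longleftrightarrow>
     (\<forall>(x, f)\<in>A. \<forall>(y, g)\<in>A. blinfun_apply (f - g) (x - y) \<ge> 0)"

definition maximal_monotone_operator :: "('a::real_normed_vector \<times> 'a dual) set \<Rightarrow> bool" where
  "maximal_monotone_operator A \<longleftrightarrow>
     monotone_operator A \<and> (\<forall>A'. monotone_operator A' \<and> A \<subseteq> A' \<longrightarrow> A = A')"

definition zeros :: "('a::real_normed_vector \<times> 'a dual) set \<Rightarrow> 'a set" where
  "zeros A = {x. (x, 0) \<in> A}"

definition op_add ::
  "('a::real_normed_vector \<times> 'a dual) set \<Rightarrow> ('a \<times> 'a dual) set \<Rightarrow> ('a \<times> 'a dual) set" where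
  "op_add A B = {(x, f + g) | x f g. (x, f) \<in> A \<and> (x, g) \<in> B}"

definition op_scale ::
  "real \<Rightarrow> ('a::real_normed_vector \<times> 'a dual) set \<Rightarrow> ('a \<times> 'a dual) set" where
  "op_scale r A = {(x, r *\<^sub>R f) | x f. (x, f) \<in> A}"

text \<open>
  The composition \<open>(J + rA)\<^sup>-\<^sup>1 J\<close>, read as a function. Relational composition \<open>O\<close> applies its
  left argument first.
\<close>

definition resolvent :: "('a::real_normed_vector \<times> 'a dual) set \<Rightarrow> real \<Rightarrow> 'a \<Rightarrow> 'a" where
  "resolvent A r x =
     (THE z. (x, z) \<in> duality_mapping O (op_add duality_mapping (op_scale r A))\<inverse>)"

end

theory Submission imports Defs begin

text \<open>
  Write \<open>p = Q (zeros A) u\<close>, \<open>y\<^sub>n = resolvent A (r n) (x n)\<close> and \<open>s\<^sub>n = phi p (x n)\<close>. The identity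
  \<open>phi_three_point\<close> gives \<open>phi p y\<^sub>n + phi y\<^sub>n x\<^sub>n \<le> s\<^sub>n\<close> (\<open>phi_resolvent\<close>) and
  \<open>s\<^sub>n\<^sub>+\<^sub>1 \<le> (1 - \<alpha>\<^sub>n) s\<^sub>n + \<alpha>\<^sub>n \<tau>\<^sub>n\<close> with \<open>\<tau>\<^sub>n = 2 \<langle>x\<^sub>n\<^sub>+\<^sub>1 - p, J u - J p\<rangle>\<close> (\<open>phi_anchored_step\<close>).
  If \<open>s\<close> does not drop by a fixed amount at step \<open>n\<close>, then \<open>phi y\<^sub>n x\<^sub>n\<close> is small for large \<open>n\<close>, hence
  so are \<open>y\<^sub>n - x\<^sub>n\<close> and \<open>x\<^sub>n\<^sub>+\<^sub>1 - y\<^sub>n\<close>; uniform norm to weak-star continuity of \<open>J\<close> then shows that weak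
  cluster points of such \<open>y\<^sub>n\<close> are zeros of \<open>A\<close> (\<open>weak_cluster_point_zero\<close>), and the variational
  inequality of the projection (\<open>Q_variational\<close>) bounds \<open>\<tau>\<^sub>n\<close> by any given \<open>\<delta> > 0\<close>. If \<open>s\<close> does drop
  by a fixed amount, the same recursion with \<open>\<delta>\<close> in place of \<open>\<tau>\<^sub>n\<close> holds because \<open>\<alpha>\<^sub>n\<close> tends to
  \<open>0\<close>. So it holds for all large \<open>n\<close>, and the divergence of the sum of the weights forces
  \<open>s\<^sub>n\<close> to tend to \<open>0\<close> (\<open>contraction_divergent_sum_tendsto_0\<close>), which by uniform convexity is strong
  convergence.

  The supporting theory avoids the weak topologies, reflexivity and the Hahn-Banach theorem. The
  values of \<open>J\<close> are gradients of half the squared norm. Minimizing sequences are Cauchy by uniform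
  convexity, so a decreasing sequence of closed convex sets that all meet one bounded set has a
  common point (\<open>nested_minimizer\<close>); this yields surjectivity of \<open>J\<close>, the generalized projection,
  and points that serve as weak cluster points. That resolvents exist amounts to
  solving \<open>(x, - J x) \<in> B\<close> for monotone \<open>B\<close> that is maximal. For this the function
  \<open>(norm a)\<^sup>2 / 2 + (norm b)\<^sup>2 / 2 + c\<close> is minimized over the convex hull of the points
  \<open>(y, f, f y)\<close> with \<open>(y, f) \<in> B\<close>. On a minimizing sequence both \<open>a\<close> and \<open>inv J b\<close> are Cauchy, the
  first by uniform convexity and the second from the first-order optimality conditions, which in
  the limit are exactly the inequalities required (\<open>monotone_saddle\<close>).
\<close>

section \<open>Uniform convexity\<close>

text \<open>The defect of midpoint convexity of the squared norm.\<close>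

definition midgap :: "'a::real_normed_vector \<Rightarrow> 'a \<Rightarrow> real" where
  "midgap x y = ((norm x)\<^sup>2 + (norm y)\<^sup>2) / 2 - (norm ((1/2) *\<^sub>R (x + y)))\<^sup>2"

lemma norm_midpoint_le: "norm ((1/2) *\<^sub>R (x + y)) \<le> (norm x + norm y) / 2"
  for x y :: "'a::real_normed_vector"
  using norm_triangle_ineq[of x y] by simp

lemma midgap_ge_norm_diff: "(norm x - norm y)\<^sup>2 / 4 \<le> midgap x y"
proof -
  have "(norm ((1/2) *\<^sub>R (x + y)))\<^sup>2 \<le> ((norm x + norm y) / 2)\<^sup>2"
    by (rule power_mono[OF norm_midpoint_le]) simp
  then show ?thesis
    unfolding midgap_def by (simp add: power2_eq_square field_simps)
qed

lemma midgap_nonneg: "0 \<le> midgap x y"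
  using midgap_ge_norm_diff[of x y] by (smt (verit) divide_nonneg_nonneg zero_le_power2)

lemma half_sq_midpoint:
  "(norm ((1/2) *\<^sub>R (x + y)))\<^sup>2 / 2 = ((norm x)\<^sup>2 / 2 + (norm y)\<^sup>2 / 2) / 2 - midgap x (y::'a::real_normed_vector) / 2"
  by (simp add: midgap_def field_simps)

text \<open>If the norms of \<open>x\<close> and \<open>y\<close> differ by \<open>\<eta>\<close> or more, already the norms produce the gap;
  otherwise uniform convexity is applied on the sphere through the longer vector.\<close>

lemma midgap_uniform_aux:
  fixes x y :: "'a::real_normed_vector"
  assumes \<delta>: "\<And>x y::'a. norm x = 1 \<Longrightarrow> norm y = 1 \<Longrightarrow> e \<le> norm (x - y)
                \<Longrightarrow> norm ((1/2) *\<^sub>R (x + y)) \<le> 1 - \<delta>"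
    and \<delta>0: "0 < \<delta>" and \<epsilon>: "0 < \<epsilon>"
    and \<eta>: "0 < \<eta>" "\<eta> \<le> \<epsilon> / 4" "\<eta> \<le> \<epsilon> * \<delta> / 4"
    and R: "0 < R" and e: "e \<le> (3 * \<epsilon> / 4) / R"
    and x: "norm x \<le> R" and y: "norm y \<le> R" and yx: "norm y \<le> norm x"
    and dist: "\<epsilon> \<le> norm (x - y)"
  shows "min (\<eta>\<^sup>2 / 4) (\<epsilon>\<^sup>2 * \<delta> / 16) \<le> midgap x y"
proof (cases "\<eta> \<le> norm x - norm y")
  case True
  then have "\<eta>\<^sup>2 \<le> (norm x - norm y)\<^sup>2"
    using \<eta> by (intro power_mono) auto
  then show ?thesis using midgap_ge_norm_diff[of x y] by linarith
next
  case False
  define a b where "a = norm x" and "b = norm y"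
  have ab: "a - b < \<eta>" "b \<le> a" using False yx by (auto simp: a_def b_def)
  have "\<epsilon> \<le> a + b" using dist norm_triangle_ineq4[of x y] by (simp add: a_def b_def)
  then have a: "\<epsilon> / 2 \<le> a" using ab by linarith
  then have a0: "0 < a" using \<epsilon> by linarith
  have b: "0 < b" using a ab \<eta> \<epsilon> by linarith
  \<comment> \<open>\<open>y\<close> is moved radially onto the sphere through \<open>x\<close>\<close>
  define y' where "y' = (a / b) *\<^sub>R y"
  have ny': "norm y' = a" using b a0 by (simp add: y'_def b_def)
  have "y' - y = ((a - b) / b) *\<^sub>R y"
    using b by (simp add: y'_def diff_divide_distrib scaleR_diff_left)
  then have dy: "norm (y' - y) = a - b" using b ab by (simp add: b_def)
  have "norm (x - y) \<le> norm (x - y') + norm (y' - y)"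
    by (metis diff_add_cancel norm_triangle_ineq add_diff_eq)
  then have "3 * \<epsilon> / 4 \<le> norm (x - y')" using dist dy ab \<eta> by linarith
  then have "(3 * \<epsilon> / 4) / R \<le> norm (x - y') / a"
    using a0 x R \<epsilon> by (intro frac_le) (auto simp: a_def)
  also have "norm (x - y') / a = norm ((1/a) *\<^sub>R x - (1/a) *\<^sub>R y')"
    using a0 by (simp flip: scaleR_diff_right)
  finally have "norm ((1/2) *\<^sub>R ((1/a) *\<^sub>R x + (1/a) *\<^sub>R y')) \<le> 1 - \<delta>"
    using e a0 ny' by (intro \<delta>) (auto simp: a_def)
  moreover have "norm ((1/2) *\<^sub>R ((1/a) *\<^sub>R x + (1/a) *\<^sub>R y')) = norm ((1/2) *\<^sub>R (x + y')) / a"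
    using a0 by (simp flip: scaleR_add_right)
  ultimately have "norm ((1/2) *\<^sub>R (x + y')) / a \<le> 1 - \<delta>"
    by metis
  then have m': "norm ((1/2) *\<^sub>R (x + y')) \<le> a * (1 - \<delta>)"
    unfolding pos_divide_le_eq[OF a0] by (metis mult.commute)
  have "(1/2) *\<^sub>R (x + y) = (1/2) *\<^sub>R (x + y') - (1/2) *\<^sub>R (y' - y)"
    by (simp add: algebra_simps)
  then have "norm ((1/2) *\<^sub>R (x + y)) \<le> norm ((1/2) *\<^sub>R (x + y')) + norm ((1/2) *\<^sub>R (y' - y))"
    by (metis norm_triangle_ineq4)
  then have m: "norm ((1/2) *\<^sub>R (x + y)) \<le> a * (1 - \<delta>) + (a - b) / 2"
    using m' dy by simp
  define m where "m = norm ((1/2) *\<^sub>R (x + y))"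
  have m0: "0 \<le> m" by (simp add: m_def)
  have "\<epsilon> * \<delta> / 2 \<le> a * \<delta>" using a \<delta>0 mult_right_mono[of "\<epsilon>/2" a \<delta>] by simp
  then have d: "\<epsilon> * \<delta> / 4 \<le> (a + b) / 2 - m"
    using m ab \<eta> unfolding m_def[symmetric] right_diff_distrib add_divide_distrib diff_divide_distrib
    by linarith
  have s: "\<epsilon> / 4 \<le> (a + b) / 2 + m" using a b m0 unfolding add_divide_distrib by linarith
  have "(\<epsilon> * \<delta> / 4) * (\<epsilon> / 4) \<le> ((a + b) / 2 - m) * ((a + b) / 2 + m)"
  proof (rule mult_mono[OF d s])
    show "0 \<le> \<epsilon> / 4" using \<epsilon> by simp
    have "0 \<le> \<epsilon> * \<delta> / 4" using \<epsilon> \<delta>0 by simp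
    then show "0 \<le> (a + b) / 2 - m" using d by linarith
  qed
  also have "\<dots> = ((a + b) / 2)\<^sup>2 - m\<^sup>2" by (simp add: power2_eq_square algebra_simps)
  also have "\<dots> \<le> (a\<^sup>2 + b\<^sup>2) / 2 - m\<^sup>2"
    using zero_le_power2[of "a - b"] by (simp add: power2_eq_square field_simps)
  also have "\<dots> = midgap x y" by (simp add: midgap_def a_def b_def m_def)
  finally have "\<epsilon>\<^sup>2 * \<delta> / 16 \<le> midgap x y" by (simp add: power2_eq_square algebra_simps)
  then show ?thesis by linarith
qed

lemma midgap_commute: "midgap x y = midgap y x"
  by (simp add: midgap_def add.commute)

text \<open>Uniform convexity, transferred from the unit sphere to bounded sets and from the norm
  to its square.\<close>

lemma uniformly_convex_midgap:
  fixes R \<epsilon> :: real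
  assumes uc: "uniformly_convex_space TYPE('a::real_normed_vector)" and \<epsilon>: "0 < \<epsilon>"
  obtains \<delta> where "0 < \<delta>" "\<And>x y::'a. norm x \<le> R \<Longrightarrow> norm y \<le> R \<Longrightarrow> midgap x y < \<delta>
                      \<Longrightarrow> norm (x - y) < \<epsilon>"
proof -
  define R' where "R' = max R 1"
  have R': "0 < R'" by (simp add: R'_def)
  define e where "e = min 2 ((3 * \<epsilon> / 4) / R')"
  have "0 < e" "e \<le> 2" using \<epsilon> R' by (auto simp: e_def)
  then obtain \<delta> where \<delta>0: "0 < \<delta>" and \<delta>: "\<And>x y::'a. norm x = 1 \<Longrightarrow> norm y = 1 \<Longrightarrow> e \<le> norm (x - y)
                \<Longrightarrow> norm ((1/2) *\<^sub>R (x + y)) \<le> 1 - \<delta>"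
    using uc[unfolded uniformly_convex_space_def, rule_format, of e] by (auto simp: dist_norm)
  define \<eta> where "\<eta> = min (\<epsilon> / 4) (\<epsilon> * \<delta> / 4)"
  have \<eta>: "0 < \<eta>" "\<eta> \<le> \<epsilon> / 4" "\<eta> \<le> \<epsilon> * \<delta> / 4" using \<epsilon> \<delta>0 by (auto simp: \<eta>_def)
  define \<delta>' where "\<delta>' = min (\<eta>\<^sup>2 / 4) (\<epsilon>\<^sup>2 * \<delta> / 16)"
  have "0 < \<delta>'" using \<eta> \<epsilon> \<delta>0 by (auto simp: \<delta>'_def)
  moreover have "norm (x - y) < \<epsilon>" if "norm x \<le> R" "norm y \<le> R" "midgap x y < \<delta>'" for x y :: 'a
  proof (rule ccontr)
    assume "\<not> norm (x - y) < \<epsilon>"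
    then have d: "\<epsilon> \<le> norm (x - y)" "\<epsilon> \<le> norm (y - x)" by (auto simp: norm_minus_commute)
    have b: "norm x \<le> R'" "norm y \<le> R'" using that by (auto simp: R'_def)
    have e: "e \<le> (3 * \<epsilon> / 4) / R'" by (simp add: e_def)
    have "\<delta>' \<le> midgap x y"
    proof (cases "norm y \<le> norm x")
      case True
      show ?thesis unfolding \<delta>'_def
        by (rule midgap_uniform_aux[OF \<delta> \<delta>0 \<epsilon> \<eta> R' e]) (use b d True in auto)
    next
      case False
      show ?thesis unfolding \<delta>'_def midgap_commute[of x]
        by (rule midgap_uniform_aux[OF \<delta> \<delta>0 \<epsilon> \<eta> R' e]) (use b d False in auto)
    qed
    with that show False by simp
  qed
  ultimately show ?thesis using that by blast
qed

section \<open>Maximal monotone operators\<close>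

lemma maximal_monotone_memI:
  assumes A: "maximal_monotone_operator A"
    and rel: "\<And>y g. (y, g) \<in> A \<Longrightarrow> 0 \<le> blinfun_apply (f - g) (x - y)"
  shows "(x, f) \<in> A"
proof -
  have sym: "blinfun_apply (g - f) (y - x) = blinfun_apply (f - g) (x - y)" for y g
    by (simp add: blinfun.diff_left blinfun.diff_right)
  have "monotone_operator (insert (x, f) A)"
    using A rel unfolding maximal_monotone_operator_def monotone_operator_def
    by (auto simp: sym)
  then have "A = insert (x, f) A"
    using A unfolding maximal_monotone_operator_def by blast
  then show ?thesis by blast
qed

lemma maximal_monotone_monotone:
  assumes "maximal_monotone_operator A" "(x, f) \<in> A" "(y, g) \<in> A"
  shows "0 \<le> blinfun_apply (f - g) (x - y)"
proof -
  have "\<forall>(x, f)\<in>A. \<forall>(y, g)\<in>A. 0 \<le> blinfun_apply (f - g) (x - y)"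
    using assms(1) unfolding maximal_monotone_operator_def monotone_operator_def by simp
  from bspec[OF this assms(2)] show ?thesis using assms(3) by auto
qed

lemma zeros_iff:
  assumes A: "maximal_monotone_operator A"
  shows "z \<in> zeros A \<longleftrightarrow> (\<forall>(y, g)\<in>A. 0 \<le> blinfun_apply g (y - z))"
proof
  assume "z \<in> zeros A"
  then show "\<forall>(y, g)\<in>A. 0 \<le> blinfun_apply g (y - z)"
    using maximal_monotone_monotone[OF A, of _ _ z 0] by (auto simp: zeros_def)
next
  assume z: "\<forall>(y, g)\<in>A. 0 \<le> blinfun_apply g (y - z)"
  have "(z, 0) \<in> A"
  proof (rule maximal_monotone_memI[OF A])
    fix y g assume "(y, g) \<in> A"
    then show "0 \<le> blinfun_apply (0 - g) (z - y)"
      using z by (auto simp: blinfun.minus_left blinfun.diff_right)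
  qed
  then show "z \<in> zeros A" by (simp add: zeros_def)
qed

lemma closed_zeros:
  fixes A :: "('a::real_normed_vector \<times> 'a dual) set"
  assumes "maximal_monotone_operator A"
  shows "closed (zeros A)"
proof -
  have "zeros A = (\<Inter>(y, g)\<in>A. {z. 0 \<le> blinfun_apply g (y - z)})"
    using zeros_iff[OF assms] by auto
  moreover have "closed {z. 0 \<le> blinfun_apply g (y - z)}" for y and g :: "'a dual"
    by (intro closed_Collect_le continuous_intros)
  ultimately show ?thesis by (auto intro!: closed_INT)
qed

lemma convex_zeros:
  assumes "maximal_monotone_operator A"
  shows "convex (zeros A)"
proof (rule convexI)
  fix z w and a b :: real
  assume zw: "z \<in> zeros A" "w \<in> zeros A" and ab: "0 \<le> a" "0 \<le> b" "a + b = 1"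
  show "a *\<^sub>R z + b *\<^sub>R w \<in> zeros A"
    unfolding zeros_iff[OF assms]
  proof safe
    fix y g assume yg: "(y, g) \<in> A"
    have "y = a *\<^sub>R y + b *\<^sub>R y" using ab by (metis scaleR_add_left scaleR_one)
    then have "y - (a *\<^sub>R z + b *\<^sub>R w) = a *\<^sub>R (y - z) + b *\<^sub>R (y - w)"
      by (metis add_diff_add scaleR_right_diff_distrib)
    moreover have "0 \<le> blinfun_apply g (y - z)" "0 \<le> blinfun_apply g (y - w)"
      using zw yg zeros_iff[OF assms] by auto
    ultimately show "0 \<le> blinfun_apply g (y - (a *\<^sub>R z + b *\<^sub>R w))"
      using ab by (simp only: blinfun.add_right blinfun.scaleR_right) simp
  qed
qed

lemma convex_graph_halfspace:
  "convex {(a, b, c). blinfun_apply b y + blinfun_apply f a - (c::real) \<le> k}"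
  for y :: "'a::real_normed_vector" and f :: "'a dual"
proof (rule convexI)
  fix w1 w2 :: "'a \<times> 'a dual \<times> real" and s t :: real
  assume w: "w1 \<in> {(a, b, c). blinfun_apply b y + f a - c \<le> k}"
      "w2 \<in> {(a, b, c). blinfun_apply b y + f a - c \<le> k}"
    and st: "0 \<le> s" "0 \<le> t" "s + t = 1"
  obtain a1 b1 c1 a2 b2 c2 where w_eq: "w1 = (a1, b1, c1)" "w2 = (a2, b2, c2)"
    by (cases w1, cases w2) auto
  have "s * (b1 y + f a1 - c1) + t * (b2 y + f a2 - c2) \<le> s * k + t * k"
    using w st unfolding w_eq by (intro add_mono mult_left_mono) auto
  also have "\<dots> = k" using st by (simp flip: distrib_right)
  finally show "s *\<^sub>R w1 + t *\<^sub>R w2 \<in> {(a, b, c). blinfun_apply b y + f a - c \<le> k}"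
    by (simp add: w_eq blinfun.add_left blinfun.add_right blinfun.scaleR_left blinfun.scaleR_right algebra_simps)
qed

text \<open>The convex hull of the graph of \<open>B\<close>, with the pairing \<open>f y\<close> recorded as a third coordinate.
  Monotonicity makes \<open>2 * b a \<le> 2 * c\<close> on this hull, so the third coordinate of each of its points
  dominates the pairing of the first two.\<close>

definition graph_hull :: "('a::real_normed_vector \<times> 'a dual) set \<Rightarrow> ('a \<times> 'a dual \<times> real) set" where
  "graph_hull B = convex hull ((\<lambda>(y, f). (y, f, blinfun_apply f y)) ` B)"

lemma graph_hull_monotone:
  assumes B: "monotone_operator B" and w: "(a, b, c) \<in> graph_hull B" "(a', b', c') \<in> graph_hull B"
  shows "b' a + b a' \<le> c + c'"
proof -
  \<comment> \<open>Monotonicity is an affine inequality in each of the two points separately, so it passes to the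
    hull in one point and then in the other.\<close>
  have sub: "graph_hull B \<subseteq> {(a, b, c). blinfun_apply b y + f a - c \<le> f y}" if "(y, f) \<in> B" for y f
    unfolding graph_hull_def
  proof (rule hull_minimal, rule image_subsetI, clarify)
    fix y' f' assume "(y', f') \<in> B"
    then have "0 \<le> (f - f') (y - y')"
      using B that unfolding monotone_operator_def by blast
    then show "f' y + f y' - f' y' \<le> f y" by (simp add: blinfun.diff_left blinfun.diff_right)
  qed (rule convex_graph_halfspace)
  have "graph_hull B \<subseteq> {(a', b', c'). blinfun_apply b' a + b a' - c' \<le> c}"
    unfolding graph_hull_def
  proof (rule hull_minimal, rule image_subsetI, clarify)
    fix y f assume "(y, f) \<in> B"
    then have "b y + f a - c \<le> f y" using sub[of y f] w(1) by auto
    then show "f a + b y - f y \<le> c" by simp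
  qed (rule convex_graph_halfspace)
  then show ?thesis using w(2) by auto
qed

section \<open>The duality mapping\<close>

text \<open>The derivative of half the squared norm at \<open>x\<close> in direction \<open>y\<close>; \<open>Lim\<close> carries no
  information where the norm is not differentiable.\<close>

definition half_sq_deriv :: "'a::real_normed_vector \<Rightarrow> 'a \<Rightarrow> real" where
  "half_sq_deriv x y = Lim (at 0) (\<lambda>t. ((norm (x + t *\<^sub>R y))\<^sup>2 / 2 - (norm x)\<^sup>2 / 2) / t)"

text \<open>The standing hypotheses on the space. The parameter \<open>space\<close> only carries the type.\<close>

locale smooth_uniformly_convex =
  fixes space :: "'a::banach itself"
  assumes uc: "uniformly_convex_space TYPE('a)"
    and ug: "uniformly_gateaux_differentiable_norm TYPE('a)"
begin

lemma norm_deriv_exists_unit: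
  fixes x y :: 'a
  assumes "norm x = 1" "norm y = 1"
  shows "\<exists>l. ((\<lambda>t. (norm (x + t *\<^sub>R y) - norm x) / t) \<longlongrightarrow> l) (at 0)"
proof -
  have "y \<in> sphere 0 1" using assms by simp
  then obtain l where
    "uniform_limit (sphere 0 1) (\<lambda>(t::real) x. (norm (x + t *\<^sub>R y) - norm x) / t) l (at 0)"
    using ug unfolding uniformly_gateaux_differentiable_norm_def by blast
  from tendsto_uniform_limitI[OF this, of x] show ?thesis using assms by auto
qed

lemma norm_deriv_exists:
  fixes x y :: 'a
  assumes "x \<noteq> 0"
  shows "\<exists>l. ((\<lambda>t. (norm (x + t *\<^sub>R y) - norm x) / t) \<longlongrightarrow> l) (at 0)"
proof (cases "y = 0")
  case False
  define a b where "a = norm x" and "b = norm y"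
  have ab: "0 < a" "0 < b" using assms False by (auto simp: a_def b_def)
  define x' y' where "x' = (1/a) *\<^sub>R x" and "y' = (1/b) *\<^sub>R y"
  have xy: "x = a *\<^sub>R x'" "y = b *\<^sub>R y'" "norm x' = 1" "norm y' = 1"
    using ab by (auto simp: x'_def y'_def a_def b_def)
  obtain l where l: "((\<lambda>t. (norm (x' + t *\<^sub>R y') - norm x') / t) \<longlongrightarrow> l) (at 0)"
    using norm_deriv_exists_unit xy by blast
  have "filterlim (\<lambda>t. (b / a) * t) (at 0) (at 0)"
  proof (rule filterlim_atI)
    show "((\<lambda>t. (b / a) * t) \<longlongrightarrow> 0) (at 0)" by (rule tendsto_mult_right_zero) simp
    have "b / a \<noteq> 0" using ab by simp
    then show "\<forall>\<^sub>F t in at 0. (b / a) * t \<noteq> 0"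
      by (simp add: eventually_at_filter)
  qed
  from filterlim_compose[OF l this]
  have "((\<lambda>t. b * ((norm (x' + ((b/a) * t) *\<^sub>R y') - norm x') / ((b/a) * t))) \<longlongrightarrow> b * l) (at 0)"
    by (intro tendsto_mult_left)
  moreover have "b * ((norm (x' + ((b/a) * t) *\<^sub>R y') - norm x') / ((b/a) * t))
      = (norm (x + t *\<^sub>R y) - norm x) / t" for t
  proof -
    have "a *\<^sub>R (x' + ((b/a) * t) *\<^sub>R y') = a *\<^sub>R x' + t *\<^sub>R (b *\<^sub>R y')"
      using ab by (simp add: scaleR_add_right mult.commute)
    then have "a *\<^sub>R (x' + ((b/a) * t) *\<^sub>R y') = x + t *\<^sub>R y"
      unfolding xy(1,2)[symmetric] .
    then have "norm (x + t *\<^sub>R y) = a * norm (x' + ((b/a) * t) *\<^sub>R y')"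
      using ab by (metis abs_of_pos norm_scaleR)
    moreover have "norm x = a * norm x'" using xy(3) by (simp add: a_def)
    moreover have "b * ((N - M) / ((b/a) * t)) = (a * N - a * M) / t" for N M
      using ab by (cases "t = 0") (simp_all add: field_simps)
    ultimately show ?thesis by metis
  qed
  ultimately show ?thesis by auto
qed auto

lemma half_sq_deriv_lim:
  fixes x y :: 'a
  shows "((\<lambda>t. ((norm (x + t *\<^sub>R y))\<^sup>2 / 2 - (norm x)\<^sup>2 / 2) / t) \<longlongrightarrow> half_sq_deriv x y) (at 0)"
proof -
  have "\<exists>l. ((\<lambda>t. ((norm (x + t *\<^sub>R y))\<^sup>2 / 2 - (norm x)\<^sup>2 / 2) / t) \<longlongrightarrow> l) (at 0)"
  proof (cases "x = 0")
    case True
    have "((\<lambda>t::real. t * (norm y)\<^sup>2 / 2) \<longlongrightarrow> 0) (at 0)" by (auto intro!: tendsto_eq_intros)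
    then have "((\<lambda>t. ((norm (x + t *\<^sub>R y))\<^sup>2 / 2 - (norm x)\<^sup>2 / 2) / t) \<longlongrightarrow> 0) (at 0)"
      by (rule Lim_transform_eventually)
        (auto simp: True power_mult_distrib eventually_at_filter power2_eq_square abs_if intro!: always_eventually)
    then show ?thesis by auto
  next
    case False
    then obtain l where l: "((\<lambda>t. (norm (x + t *\<^sub>R y) - norm x) / t) \<longlongrightarrow> l) (at 0)"
      using norm_deriv_exists by blast
    have "((\<lambda>t. (norm (x + t *\<^sub>R y) + norm x) / 2) \<longlongrightarrow> (norm (x + 0 *\<^sub>R y) + norm x) / 2) (at 0)"
      by (intro tendsto_intros) auto
    from tendsto_mult[OF this l] show ?thesis
      by (auto simp: power2_eq_square field_simps)
  qed
  then obtain l where l: "((\<lambda>t. ((norm (x + t *\<^sub>R y))\<^sup>2 / 2 - (norm x)\<^sup>2 / 2) / t) \<longlongrightarrow> l) (at 0)" ..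
  then show ?thesis unfolding half_sq_deriv_def
    using tendsto_Lim[OF trivial_limit_at l] by simp
qed

lemma half_sq_deriv_cmult:
  fixes x y :: 'a
  shows "half_sq_deriv x (c *\<^sub>R y) = c * half_sq_deriv x y"
proof (cases "c = 0")
  case True
  have "((\<lambda>t::real. 0) \<longlongrightarrow> half_sq_deriv x (0::'a)) (at 0)"
    using half_sq_deriv_lim[of x 0] by simp
  then have "half_sq_deriv x (0::'a) = 0"
    by (metis LIM_const_eq)
  then show ?thesis using True by simp
next
  case False
  have "filterlim (\<lambda>t. c * t) (at 0) (at 0)"
  proof (rule filterlim_atI)
    show "((\<lambda>t. c * t) \<longlongrightarrow> 0) (at 0)" by (auto intro!: tendsto_eq_intros)
    show "\<forall>\<^sub>F t in at 0. c * t \<noteq> 0"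
      using False by (simp add: eventually_at_filter)
  qed
  from tendsto_mult_left[OF filterlim_compose[OF half_sq_deriv_lim[of x y] this], of c]
  have "((\<lambda>t. ((norm (x + t *\<^sub>R (c *\<^sub>R y)))\<^sup>2 / 2 - (norm x)\<^sup>2 / 2) / t) \<longlongrightarrow> c * half_sq_deriv x y) (at 0)"
    using False by (simp add: mult.commute)
  then show ?thesis
    by (rule tendsto_unique[OF trivial_limit_at half_sq_deriv_lim])
qed

text \<open>Convexity of the squared norm makes its directional derivative subadditive; together with
  oddness this gives additivity. So the gradient itself is the functional \<open>J x\<close>, and the
  Hahn-Banach theorem is not needed.\<close>

lemma half_sq_deriv_subadd:
  fixes x y z :: 'a
  shows "half_sq_deriv x (y + z) \<le> half_sq_deriv x y + half_sq_deriv x z"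
proof -
  let ?q = "\<lambda>y t. ((norm (x + t *\<^sub>R y))\<^sup>2 / 2 - (norm x)\<^sup>2 / 2) / t"
  have lim: "(?q y \<longlongrightarrow> half_sq_deriv x y) (at_right 0)" for y
    using half_sq_deriv_lim[of x y] by (rule filterlim_mono[OF _ order_refl at_le]) simp
  have "?q (y + z) t \<le> (?q (2 *\<^sub>R y) t + ?q (2 *\<^sub>R z) t) / 2" if "0 < t" for t
  proof -
    have e: "(1/2) *\<^sub>R ((x + t *\<^sub>R (2 *\<^sub>R y)) + (x + t *\<^sub>R (2 *\<^sub>R z))) = x + t *\<^sub>R (y + z)"
      by (simp add: algebra_simps flip: scaleR_2)
    have "(norm (x + t *\<^sub>R (y + z)))\<^sup>2 \<le> ((norm (x + t *\<^sub>R (2 *\<^sub>R y)))\<^sup>2 + (norm (x + t *\<^sub>R (2 *\<^sub>R z)))\<^sup>2) / 2"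
      using midgap_nonneg[of "x + t *\<^sub>R (2 *\<^sub>R y)" "x + t *\<^sub>R (2 *\<^sub>R z)"]
      unfolding midgap_def e by linarith
    then have "((norm (x + t *\<^sub>R (y + z)))\<^sup>2 / 2 - (norm x)\<^sup>2 / 2) / t
      \<le> (((norm (x + t *\<^sub>R (2 *\<^sub>R y)))\<^sup>2 / 2 - (norm x)\<^sup>2 / 2)
         + ((norm (x + t *\<^sub>R (2 *\<^sub>R z)))\<^sup>2 / 2 - (norm x)\<^sup>2 / 2)) / 2 / t"
      using that by (intro divide_right_mono) auto
    then show ?thesis unfolding add_divide_distrib by (simp only: divide_divide_eq_left mult.commute)
  qed
  then have "\<forall>\<^sub>F t in at_right 0. ?q (y + z) t \<le> (?q (2 *\<^sub>R y) t + ?q (2 *\<^sub>R z) t) / 2"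
    by (auto simp: eventually_at_filter)
  then have "half_sq_deriv x (y + z) \<le> (half_sq_deriv x (2 *\<^sub>R y) + half_sq_deriv x (2 *\<^sub>R z)) / 2"
    by (rule tendsto_le[OF trivial_limit_at_right_real _ lim, rotated]) (intro tendsto_intros lim, simp)
  then show ?thesis by (simp add: half_sq_deriv_cmult)
qed

lemma half_sq_deriv_add:
  fixes x y z :: 'a
  shows "half_sq_deriv x (y + z) = half_sq_deriv x y + half_sq_deriv x z"
proof -
  have "half_sq_deriv x (-1 *\<^sub>R (y + z)) \<le> half_sq_deriv x (-1 *\<^sub>R y) + half_sq_deriv x (-1 *\<^sub>R z)"
    unfolding scaleR_add_right by (rule half_sq_deriv_subadd)
  then show ?thesis using half_sq_deriv_subadd[of x y z] unfolding half_sq_deriv_cmult by simp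
qed

text \<open>A subgradient of a differentiable convex function is its derivative.\<close>

lemma half_sq_deriv_eqI:
  fixes x y :: 'a
  assumes "\<And>t. t * c \<le> (norm (x + t *\<^sub>R y))\<^sup>2 / 2 - (norm x)\<^sup>2 / 2"
  shows "half_sq_deriv x y = c"
proof (rule antisym)
  let ?q = "\<lambda>t. ((norm (x + t *\<^sub>R y))\<^sup>2 / 2 - (norm x)\<^sup>2 / 2) / t"
  have r: "(?q \<longlongrightarrow> half_sq_deriv x y) (at_right 0)" and l: "(?q \<longlongrightarrow> half_sq_deriv x y) (at_left 0)"
    using half_sq_deriv_lim[of x y] by (auto intro: filterlim_mono[OF _ order_refl at_le])
  have "\<forall>\<^sub>F t in at_right 0. c \<le> ?q t"
    unfolding eventually_at_filter
    by (rule always_eventually) (use assms in \<open>simp add: pos_le_divide_eq mult.commute\<close>)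
  then show "c \<le> half_sq_deriv x y"
    by (rule tendsto_lowerbound[OF r]) simp
  have "\<forall>\<^sub>F t in at_left 0. ?q t \<le> c"
    unfolding eventually_at_filter
    by (rule always_eventually) (use assms in \<open>simp add: neg_divide_le_eq mult.commute\<close>)
  then show "half_sq_deriv x y \<le> c"
    by (rule tendsto_upperbound[OF l]) simp
qed

lemma half_sq_deriv_le:
  fixes x y :: 'a
  shows "half_sq_deriv x y \<le> norm x * norm y"
proof -
  let ?q = "\<lambda>t. ((norm (x + t *\<^sub>R y))\<^sup>2 / 2 - (norm x)\<^sup>2 / 2) / t"
  have r: "(?q \<longlongrightarrow> half_sq_deriv x y) (at_right 0)"
    using half_sq_deriv_lim[of x y] by (rule filterlim_mono[OF _ order_refl at_le]) simp
  have b: "((\<lambda>t. norm x * norm y + t * (norm y)\<^sup>2 / 2) \<longlongrightarrow> norm x * norm y) (at_right 0)"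
    by (auto intro!: tendsto_eq_intros)
  have "?q t \<le> norm x * norm y + t * (norm y)\<^sup>2 / 2" if "0 < t" for t
  proof -
    have "norm (x + t *\<^sub>R y) \<le> norm x + t * norm y"
      using norm_triangle_ineq[of x "t *\<^sub>R y"] that by simp
    then have "(norm (x + t *\<^sub>R y))\<^sup>2 \<le> (norm x + t * norm y)\<^sup>2"
      by (intro power_mono) auto
    then show ?thesis using that by (simp add: field_simps power2_eq_square)
  qed
  then have "\<forall>\<^sub>F t in at_right 0. ?q t \<le> norm x * norm y + t * (norm y)\<^sup>2 / 2"
    by (simp add: eventually_at_filter)
  then show ?thesis
    by (rule tendsto_le[OF trivial_limit_at_right_real b r])
qed

lemma duality_mapping_exists: "\<exists>f. (x::'a, f) \<in> duality_mapping"
proof -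
  have abs: "\<bar>half_sq_deriv x y\<bar> \<le> norm y * norm x" for y
    using half_sq_deriv_le[of x y] half_sq_deriv_le[of x "-1 *\<^sub>R y"]
    unfolding half_sq_deriv_cmult by (simp add: abs_le_iff mult.commute)
  have "bounded_linear (half_sq_deriv x)"
    by (rule bounded_linear_intro[where K = "norm x"])
      (use abs in \<open>auto simp: half_sq_deriv_add half_sq_deriv_cmult\<close>)
  then obtain f where f: "blinfun_apply f = half_sq_deriv x"
    using bounded_linear_Blinfun_apply by blast
  have "half_sq_deriv x x = (norm x)\<^sup>2"
  proof (rule half_sq_deriv_eqI)
    fix t :: real
    have "norm (x + t *\<^sub>R x) = \<bar>1 + t\<bar> * norm x"
      by (metis norm_scaleR scaleR_add_left scaleR_one)
    then show "t * (norm x)\<^sup>2 \<le> (norm (x + t *\<^sub>R x))\<^sup>2 / 2 - (norm x)\<^sup>2 / 2"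
      using zero_le_power2[of "t * norm x"] by (simp add: power_mult_distrib field_simps power2_eq_square)
  qed
  moreover have "norm f = norm x"
  proof (rule antisym)
    show "norm f \<le> norm x" by (rule norm_blinfun_bound) (use abs in \<open>auto simp: f mult.commute\<close>)
    show "norm x \<le> norm f"
    proof (cases "x = 0")
      case False
      have "norm x * norm x \<le> norm f * norm x"
        using norm_blinfun[of f x] calculation by (simp add: f power2_eq_square)
      then show ?thesis using False by simp
    qed auto
  qed
  ultimately have "(x, f) \<in> duality_mapping" by (simp add: duality_mapping_def f)
  then show ?thesis ..
qed

lemma duality_mapping_eq_half_sq_deriv:
  assumes "(x::'a, f) \<in> duality_mapping"
  shows "blinfun_apply f y = half_sq_deriv x y"
proof (rule half_sq_deriv_eqI[symmetric])
  fix t :: real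
  have f: "f x = (norm x)\<^sup>2" "norm f = norm x"
    using assms by (auto simp: duality_mapping_def)
  have "f (x + t *\<^sub>R y) \<le> norm x * norm (x + t *\<^sub>R y)"
    using norm_blinfun[of f "x + t *\<^sub>R y"] f by simp
  also have "\<dots> \<le> ((norm x)\<^sup>2 + (norm (x + t *\<^sub>R y))\<^sup>2) / 2"
    using zero_le_power2[of "norm x - norm (x + t *\<^sub>R y)"] by (simp add: power2_eq_square field_simps)
  finally show "t * f y \<le> (norm (x + t *\<^sub>R y))\<^sup>2 / 2 - (norm x)\<^sup>2 / 2"
    using f by (simp add: blinfun.add_right blinfun.scaleR_right field_simps)
qed

lemma duality_mapping_iff: "(x::'a, f) \<in> duality_mapping \<longleftrightarrow> f = J x"
proof -
  have "f = g" if "(x, f) \<in> duality_mapping" "(x, g) \<in> duality_mapping" for f g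
    by (rule blinfun_eqI) (metis that duality_mapping_eq_half_sq_deriv)
  then show ?thesis
    unfolding J_def by (metis (mono_tags, lifting) duality_mapping_exists the_equality)
qed

lemma J_self [simp]: "J x x = (norm (x::'a))\<^sup>2" and norm_J [simp]: "norm (J (x::'a)) = norm x"
  using duality_mapping_iff[of x "J x"] by (auto simp: duality_mapping_def)

lemma J_le: "J x y \<le> norm x * norm (y::'a)"
  using norm_blinfun[of "J x" y] by simp

lemma J_eqI:
  fixes x :: 'a
  assumes "\<And>y t. t * blinfun_apply f y \<le> (norm (x + t *\<^sub>R y))\<^sup>2 / 2 - (norm x)\<^sup>2 / 2"
  shows "f = J x"
proof (rule blinfun_eqI)
  fix y
  show "f y = J x y"
    using half_sq_deriv_eqI[OF assms, of y] duality_mapping_eq_half_sq_deriv[of x "J x"]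
    by (simp add: duality_mapping_iff)
qed

lemma half_sq_subgradient: "(norm x)\<^sup>2 / 2 + J x (y - x) \<le> (norm (y::'a))\<^sup>2 / 2"
proof -
  have "J x y \<le> ((norm x)\<^sup>2 + (norm y)\<^sup>2) / 2"
    using J_le[of x y] zero_le_power2[of "norm x - norm y"] by (simp add: power2_eq_square field_simps)
  then show ?thesis by (simp add: blinfun.diff_right field_simps)
qed

lemma midgap_le_0_imp_eq:
  assumes "midgap x y \<le> 0"
  shows "x = (y::'a)"
proof (rule ccontr)
  assume "x \<noteq> y"
  then have "0 < norm (x - y)" by simp
  then obtain \<delta> where "0 < \<delta>" and \<delta>: "\<And>x' y'::'a. norm x' \<le> max (norm x) (norm y)
      \<Longrightarrow> norm y' \<le> max (norm x) (norm y) \<Longrightarrow> midgap x' y' < \<delta> \<Longrightarrow> norm (x' - y') < norm (x - y)"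
    using uniformly_convex_midgap[OF uc, of "norm (x - y)" "max (norm x) (norm y)"] by metis
  then show False using \<delta>[of x y] assms by force
qed

lemma midgap_Cauchy:
  fixes z :: "nat \<Rightarrow> 'a"
  assumes R: "\<And>n. norm (z n) \<le> R"
    and gap: "\<And>\<delta>. 0 < \<delta> \<Longrightarrow> \<exists>N. \<forall>n\<ge>N. \<forall>m\<ge>n. midgap (z n) (z m) < \<delta>"
  shows "Cauchy z"
  unfolding Cauchy_altdef
proof (intro allI impI)
  fix e :: real assume "0 < e"
  then obtain \<delta> where \<delta>: "0 < \<delta>" "\<And>x y::'a. norm x \<le> R \<Longrightarrow> norm y \<le> R \<Longrightarrow> midgap x y < \<delta>
                      \<Longrightarrow> norm (x - y) < e"
    using uniformly_convex_midgap[OF uc] by metis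
  from gap[OF \<delta>(1)] obtain N where "\<forall>n\<ge>N. \<forall>m\<ge>n. midgap (z n) (z m) < \<delta>" ..
  then show "\<exists>M. \<forall>m\<ge>M. \<forall>n>m. dist (z m) (z n) < e"
    using \<delta>(2) R by (metis dist_norm less_imp_le)
qed

text \<open>A substitute for weak compactness: a decreasing sequence of closed convex sets that all meet
  a fixed sublevel set of \<open>\<lambda>x. (norm x)\<^sup>2 / 2 - f x\<close> has a common point. The common point also
  minimizes this function over the intersection.\<close>

lemma nested_minimizer:
  fixes D :: "nat \<Rightarrow> 'a set" and f :: "'a dual"
  assumes closed: "\<And>n. closed (D n)" and convex: "\<And>n. convex (D n)"
    and dec: "\<And>n m. n \<le> m \<Longrightarrow> D m \<subseteq> D n"
    and M: "\<And>n. \<exists>w\<in>D n. (norm w)\<^sup>2 / 2 - f w \<le> M"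
  shows "\<exists>z. (\<forall>n. z \<in> D n) \<and> (\<forall>w. (\<forall>n. w \<in> D n) \<longrightarrow> (norm z)\<^sup>2 / 2 - f z \<le> (norm w)\<^sup>2 / 2 - f w)"
proof -
  define h where "h x = (norm x)\<^sup>2 / 2 - f x" for x
  define d where "d n = Inf (h ` D n)" for n
  \<comment> \<open>The values \<open>d n\<close> increase to a limit, so near-minimizers \<open>z n\<close>, \<open>z m\<close> and their midpoint
    have almost the same value of \<open>h\<close>, which makes \<open>midgap (z n) (z m)\<close> small.\<close>
  have h_ge: "(norm x)\<^sup>2 / 4 - (norm f)\<^sup>2 \<le> h x" for x
  proof -
    have "f x \<le> norm f * norm x" using norm_blinfun[of f x] by simp
    moreover have "0 \<le> (norm x / 2 - norm f)\<^sup>2" by simp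
    ultimately show ?thesis by (simp add: h_def power2_eq_square algebra_simps)
  qed
  have h_lower: "- (norm f)\<^sup>2 \<le> h x" for x
    using h_ge[of x] zero_le_power2[of "norm x"] by linarith
  then have bdd: "bdd_below (h ` D n)" for n
    by (auto intro!: bdd_belowI2)
  have d_le: "d n \<le> h w" if "w \<in> D n" for n w
    unfolding d_def using bdd that by (auto intro: cInf_lower)
  have ne: "D n \<noteq> {}" for n using M[of n] by auto
  have d_M: "d n \<le> M" for n
    using M[of n] d_le[of _ n] by (force simp: h_def)
  have inc: "incseq d"
    unfolding incseq_def d_def
  proof (intro allI impI)
    fix m n :: nat assume "m \<le> n"
    then show "Inf (h ` D m) \<le> Inf (h ` D n)"
      using ne bdd dec by (intro cInf_superset_mono image_mono) auto
  qed
  then obtain L where L: "d \<longlonglongrightarrow> L" "\<And>n. d n \<le> L"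
    using incseq_convergent[of d M] d_M by blast
  have "\<exists>z\<in>D n. h z < d n + inverse (real (Suc n))" for n
  proof -
    have "Inf (h ` D n) < d n + inverse (real (Suc n))" by (simp add: d_def)
    then show ?thesis using cInf_lessD[of "h ` D n"] ne by blast
  qed
  then obtain z where z: "\<And>n. z n \<in> D n" "\<And>n. h (z n) < d n + inverse (real (Suc n))"
    by metis
  have "norm (z n) \<le> sqrt (4 * (M + 1 + (norm f)\<^sup>2))" for n
  proof (rule real_le_rsqrt)
    have "inverse (real (Suc n)) \<le> 1" by (simp add: field_simps)
    then show "(norm (z n))\<^sup>2 \<le> 4 * (M + 1 + (norm f)\<^sup>2)"
      using h_ge[of "z n"] z(2)[of n] d_M[of n] unfolding ring_distribs by linarith
  qed
  then have "Cauchy z"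
  proof (rule midgap_Cauchy)
    fix \<delta> :: real assume \<delta>: "0 < \<delta>"
    have "\<forall>\<^sub>F n in sequentially. L - \<delta>/4 < d n"
      using L(1) \<delta> by (intro order_tendstoD) auto
    moreover have "\<forall>\<^sub>F n in sequentially. inverse (real (Suc n)) < \<delta>/4"
      using LIMSEQ_inverse_real_of_nat \<delta> by (intro order_tendstoD) auto
    ultimately have "\<forall>\<^sub>F n in sequentially. L - \<delta>/4 < d n \<and> inverse (real (Suc n)) < \<delta>/4"
      by (rule eventually_conj)
    then obtain N where N: "\<And>n. N \<le> n \<Longrightarrow> L - \<delta>/4 < d n" "\<And>n. N \<le> n \<Longrightarrow> inverse (real (Suc n)) < \<delta>/4"
      unfolding eventually_sequentially by auto
    have "midgap (z n) (z m) < \<delta>" if "N \<le> n" "n \<le> m" for n m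
    proof -
      have "(1/2) *\<^sub>R z n + (1/2) *\<^sub>R z m \<in> D n"
        using z(1)[of n] z(1)[of m] dec[OF that(2)] by (intro convexD[OF convex]) auto
      then have "d n \<le> h ((1/2) *\<^sub>R (z n + z m))"
        unfolding scaleR_add_right by (rule d_le)
      also have "\<dots> = h (z n) / 2 + h (z m) / 2 - midgap (z n) (z m) / 2"
        unfolding h_def half_sq_midpoint by (simp add: blinfun.add_right blinfun.scaleR_right field_simps)
      finally have "midgap (z n) (z m) \<le> h (z n) + h (z m) - 2 * d n" by linarith
      moreover have "N \<le> m" using that by simp
      ultimately show ?thesis
        using z(2)[of n] z(2)[of m] N[OF that(1)] N[of m] L(2)[of m] by linarith
    qed
    then show "\<exists>N. \<forall>n\<ge>N. \<forall>m\<ge>n. midgap (z n) (z m) < \<delta>" by blast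
  qed
  then obtain z' where z': "z \<longlonglongrightarrow> z'" using Cauchy_convergent convergent_def by blast
  have "z' \<in> D n" for n
  proof (rule Lim_in_closed_set[OF closed _ sequentially_bot z'])
    show "\<forall>\<^sub>F m in sequentially. z m \<in> D n"
      using eventually_ge_at_top[of n] by eventually_elim (use z(1) dec in blast)
  qed
  moreover have "h z' \<le> h w" if "\<And>n. w \<in> D n" for w
  proof (rule LIMSEQ_le)
    show "(\<lambda>n. h (z n)) \<longlonglongrightarrow> h z'"
      unfolding h_def by (intro tendsto_intros z') auto
    show "(\<lambda>n. h w + inverse (real (Suc n))) \<longlonglongrightarrow> h w"
      using tendsto_add[OF tendsto_const LIMSEQ_inverse_real_of_nat, of "h w"] by simp
    show "\<exists>N. \<forall>n\<ge>N. h (z n) \<le> h w + inverse (real (Suc n))"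
    proof (intro exI allI impI)
      fix n show "h (z n) \<le> h w + inverse (real (Suc n))"
        using z(2)[of n] d_le[OF that[of n]] by linarith
    qed
  qed
  ultimately show ?thesis unfolding h_def by blast
qed

lemma minimizer_exists:
  fixes D :: "'a set" and f :: "'a dual"
  assumes "closed D" "convex D" "D \<noteq> {}"
  obtains z where "z \<in> D" "\<And>w. w \<in> D \<Longrightarrow> (norm z)\<^sup>2 / 2 - f z \<le> (norm w)\<^sup>2 / 2 - f w"
proof -
  obtain w where "w \<in> D" using assms by auto
  then have "\<And>n::nat. \<exists>w'\<in>D. (norm w')\<^sup>2 / 2 - f w' \<le> (norm w)\<^sup>2 / 2 - f w" by auto
  from nested_minimizer[OF assms(1) assms(2) order_refl this] that show ?thesis
    by auto
qed

lemma surj_J: "surj (J :: 'a \<Rightarrow> 'a dual)"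
  unfolding surj_def
proof
  fix f :: "'a dual"
  obtain x where x: "\<And>w. (norm x)\<^sup>2 / 2 - f x \<le> (norm w)\<^sup>2 / 2 - f w"
    using minimizer_exists[of UNIV f] by auto
  have "f = J x"
  proof (rule J_eqI)
    fix y and t :: real
    show "t * f y \<le> (norm (x + t *\<^sub>R y))\<^sup>2 / 2 - (norm x)\<^sup>2 / 2"
      using x[of "x + t *\<^sub>R y"] by (simp add: blinfun.add_right blinfun.scaleR_right)
  qed
  then show "\<exists>x. f = J x" ..
qed

lemma phi_ge_midgap: "2 * midgap x (y::'a) \<le> phi x y"
proof -
  define m where "m = norm ((1/2) *\<^sub>R (x + y))"
  have "J y (x + y) \<le> norm y * norm (x + y)" by (rule J_le)
  then have "J y x \<le> 2 * m * norm y - (norm y)\<^sup>2"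
    by (simp add: m_def blinfun.add_right mult.commute)
  moreover have "0 \<le> (m - norm y)\<^sup>2" by simp
  ultimately have "(norm x)\<^sup>2 + (norm y)\<^sup>2 - 2 * m\<^sup>2 \<le> phi x y"
    unfolding phi_def by (simp add: power2_eq_square algebra_simps)
  then show ?thesis unfolding midgap_def m_def add_divide_distrib ring_distribs by linarith
qed

lemma phi_nonneg: "0 \<le> phi x (y::'a)"
  using phi_ge_midgap[of x y] midgap_nonneg[of x y] by linarith

lemma phi_ge_norm_diff: "(norm x - norm y)\<^sup>2 \<le> phi x (y::'a)"
  using J_le[of y x] by (simp add: phi_def power2_eq_square algebra_simps)

lemma phi_le_0_imp_eq: "phi x y \<le> 0 \<Longrightarrow> x = (y::'a)"
  using phi_ge_midgap[of x y] by (intro midgap_le_0_imp_eq) linarith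

lemma phi_add_phi_commute: "phi x y + phi y x = 2 * (J x - J y) (x - (y::'a))"
  by (simp add: phi_def blinfun.diff_left blinfun.diff_right)

lemma J_inv_J [simp]: "J (inv J f) = (f :: 'a dual)"
  by (rule surj_f_inv_f[OF surj_J])

lemma norm_inv_J [simp]: "norm (inv J f :: 'a) = norm f"
  by (metis J_inv_J norm_J)

lemma phi_tendsto_0:
  fixes x y :: "nat \<Rightarrow> 'a"
  assumes R: "\<And>n. norm (x n) \<le> R" "\<And>n. norm (y n) \<le> R"
    and lim: "(\<lambda>n. phi (x n) (y n)) \<longlonglongrightarrow> 0"
  shows "(\<lambda>n. x n - y n) \<longlonglongrightarrow> 0"
proof (rule LIMSEQ_I)
  fix e :: real assume "0 < e"
  then obtain \<delta> where \<delta>: "0 < \<delta>" "\<And>x y::'a. norm x \<le> R \<Longrightarrow> norm y \<le> R \<Longrightarrow> midgap x y < \<delta>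
                      \<Longrightarrow> norm (x - y) < e"
    using uniformly_convex_midgap[OF uc] by metis
  have "\<forall>\<^sub>F n in sequentially. phi (x n) (y n) < 2 * \<delta>"
    using lim \<delta>(1) by (intro order_tendstoD) auto
  then obtain N where "\<And>n. N \<le> n \<Longrightarrow> phi (x n) (y n) < 2 * \<delta>"
    unfolding eventually_sequentially by auto
  then have "norm (x n - y n) < e" if "N \<le> n" for n
    using that phi_ge_midgap[of "x n" "y n"] by (intro \<delta> R) force
  then show "\<exists>no. \<forall>n\<ge>no. norm (x n - y n - 0) < e" by auto
qed

text \<open>The inverse of \<open>J\<close> is uniformly continuous on bounded sets.\<close>

lemma J_diff_tendsto_0_imp:
  fixes x y :: "nat \<Rightarrow> 'a"
  assumes R: "\<And>n. norm (x n) \<le> R" "\<And>n. norm (y n) \<le> R"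
    and lim: "(\<lambda>n. J (x n) - J (y n)) \<longlonglongrightarrow> 0"
  shows "(\<lambda>n. x n - y n) \<longlonglongrightarrow> 0"
proof (rule phi_tendsto_0[OF R])
  have b: "phi (x n) (y n) \<le> norm (J (x n) - J (y n)) * (4 * R)" for n
  proof -
    have "phi (x n) (y n) \<le> 2 * (J (x n) - J (y n)) (x n - y n)"
      using phi_add_phi_commute[of "x n" "y n"] phi_nonneg[of "y n" "x n"] by linarith
    also have "\<dots> \<le> 2 * (norm (J (x n) - J (y n)) * norm (x n - y n))"
      using norm_blinfun[of "J (x n) - J (y n)" "x n - y n"] by simp
    also have "\<dots> \<le> 2 * (norm (J (x n) - J (y n)) * (2 * R))"
      using norm_triangle_ineq4[of "x n" "y n"] R[of n] by (intro mult_left_mono) auto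
    finally show ?thesis by simp
  qed
  have "(\<lambda>n. norm (J (x n) - J (y n)) * (4 * R)) \<longlonglongrightarrow> 0"
    using tendsto_mult_left_zero[OF tendsto_norm_zero[OF lim]] .
  then show "(\<lambda>n. phi (x n) (y n)) \<longlonglongrightarrow> 0"
    by (rule tendsto_sandwich[OF _ _ tendsto_const, rotated 2]) (auto simp: phi_nonneg b)
qed

lemma J_scaleR: "0 \<le> c \<Longrightarrow> J (c *\<^sub>R x) = c *\<^sub>R J (x::'a)"
  using duality_mapping_iff[of "c *\<^sub>R x" "c *\<^sub>R J x"]
  by (auto simp: duality_mapping_def blinfun.scaleR_left blinfun.scaleR_right power_mult_distrib power2_eq_square)

text \<open>On the unit sphere \<open>J x v\<close> is the uniform limit of difference quotients of the norm, each of
  which is Lipschitz in \<open>x\<close>.\<close>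

lemma J_uniform_unit:
  fixes v :: 'a
  assumes v: "norm v = 1" and e: "0 < e"
  obtains \<delta> where "0 < \<delta>" "\<And>x z::'a. norm x = 1 \<Longrightarrow> norm z = 1 \<Longrightarrow> norm (x - z) < \<delta>
      \<Longrightarrow> \<bar>J x v - J z v\<bar> < e"
proof -
  let ?q = "\<lambda>(t::real) x. (norm (x + t *\<^sub>R v) - norm x) / t"
  have "v \<in> sphere 0 1" using v by simp
  then obtain l where l: "uniform_limit (sphere 0 1) ?q l (at 0)"
    using ug unfolding uniformly_gateaux_differentiable_norm_def by blast
  have J: "J x v = l x" if x: "norm x = 1" for x
  proof -
    have "((\<lambda>t. ?q t x) \<longlongrightarrow> l x) (at 0)"
      using tendsto_uniform_limitI[OF l, of x] x by simp
    moreover have "((\<lambda>t. (norm (x + t *\<^sub>R v) + norm x) / 2) \<longlongrightarrow> (norm (x + 0 *\<^sub>R v) + norm x) / 2) (at 0)"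
      by (intro tendsto_intros) auto
    ultimately have "((\<lambda>t. ((norm (x + t *\<^sub>R v) + norm x) / 2) * ?q t x) \<longlongrightarrow> (norm (x + 0 *\<^sub>R v) + norm x) / 2 * l x) (at 0)"
      by (rule tendsto_mult[rotated])
    then have "((\<lambda>t. ((norm (x + t *\<^sub>R v))\<^sup>2 / 2 - (norm x)\<^sup>2 / 2) / t) \<longlongrightarrow> l x) (at 0)"
      by (auto simp: power2_eq_square field_simps x)
    then have "half_sq_deriv x v = l x"
      by (rule tendsto_unique[OF trivial_limit_at half_sq_deriv_lim])
    then show ?thesis
      using duality_mapping_eq_half_sq_deriv[of x "J x" v] by (simp add: duality_mapping_iff)
  qed
  have "\<forall>\<^sub>F t in at 0. \<forall>x\<in>sphere 0 1. dist (?q t x) (l x) < e / 3"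
    using l[unfolded uniform_limit_iff, rule_format, of "e / 3"] e by simp
  moreover have "\<forall>\<^sub>F t in at (0::real). t \<noteq> 0" by (simp add: eventually_at_filter)
  ultimately have "\<forall>\<^sub>F t in at 0. t \<noteq> 0 \<and> (\<forall>x\<in>sphere 0 1. dist (?q t x) (l x) < e / 3)"
    by eventually_elim auto
  then have "\<exists>t. t \<noteq> 0 \<and> (\<forall>x\<in>sphere 0 1. dist (?q t x) (l x) < e / 3)"
    by (rule eventually_happens'[OF trivial_limit_at])
  then obtain t where t: "t \<noteq> 0" and t': "\<forall>x\<in>sphere 0 1. dist (?q t x) (l x) < e / 3"
    by blast
  have q: "dist (?q t x) (l x) < e / 3" if "norm x = 1" for x
    using t' that by simp
  define \<delta> where "\<delta> = \<bar>t\<bar> * e / 6"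
  have "0 < \<delta>" using t e by (simp add: \<delta>_def)
  moreover have "\<bar>J x v - J z v\<bar> < e" if "norm x = 1" "norm z = 1" "norm (x - z) < \<delta>" for x z
  proof -
    have "\<bar>norm (x + t *\<^sub>R v) - norm (z + t *\<^sub>R v)\<bar> \<le> norm (x - z)"
      using norm_triangle_ineq3[of "x + t *\<^sub>R v" "z + t *\<^sub>R v"] by simp
    then have "\<bar>(norm (x + t *\<^sub>R v) - norm x) - (norm (z + t *\<^sub>R v) - norm z)\<bar> < 2 * \<delta>"
      using that by linarith
    then have "\<bar>(norm (x + t *\<^sub>R v) - norm x) - (norm (z + t *\<^sub>R v) - norm z)\<bar> / \<bar>t\<bar> < 2 * \<delta> / \<bar>t\<bar>"
      using t by (intro divide_strict_right_mono) auto
    moreover have "2 * \<delta> / \<bar>t\<bar> = e / 3" using t by (simp add: \<delta>_def)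
    ultimately have "\<bar>?q t x - ?q t z\<bar> < e / 3"
      by (metis abs_divide diff_divide_distrib)
    then show ?thesis
      using q[OF that(1)] q[OF that(2)] unfolding J[OF that(1)] J[OF that(2)] dist_real_def by linarith
  qed
  ultimately show ?thesis using that by blast
qed

lemma J_uniform_bounded:
  fixes v :: 'a
  assumes v: "norm v = 1" and e: "0 < e"
  obtains \<delta> where "0 < \<delta>" "\<And>x z::'a. norm x \<le> R \<Longrightarrow> norm z \<le> R \<Longrightarrow> norm (x - z) < \<delta>
      \<Longrightarrow> \<bar>J x v - J z v\<bar> < e"
proof -
  define R' where "R' = max R 1"
  have R': "0 < R'" by (simp add: R'_def)
  then have "0 < e / (2 * R')" using e by simp
  then obtain \<delta> where \<delta>: "0 < \<delta>" "\<And>x z::'a. norm x = 1 \<Longrightarrow> norm z = 1 \<Longrightarrow> norm (x - z) < \<delta>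
      \<Longrightarrow> \<bar>J x v - J z v\<bar> < e / (2 * R')"
    using J_uniform_unit[OF v] by metis
  define \<delta>' where "\<delta>' = min (e / 8) (\<delta> * e / 16)"
  have \<delta>': "0 < \<delta>'" "\<delta>' \<le> e / 8" "\<delta>' \<le> \<delta> * e / 16" using \<delta>(1) e by (auto simp: \<delta>'_def)
  have "\<bar>J x v - J z v\<bar> < e" if xz: "norm x \<le> R" "norm z \<le> R" "norm (x - z) < \<delta>'" for x z
  proof -
    have d: "\<bar>norm x - norm z\<bar> \<le> norm (x - z)" by (rule norm_triangle_ineq3)
    have Jv: "\<bar>J w v\<bar> \<le> norm w" for w
      using norm_blinfun[of "J w" v] v by simp
    show ?thesis
    proof (cases "norm x \<le> e / 8 \<or> norm z \<le> e / 8")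
      case True
      then show ?thesis using d xz \<delta>' Jv[of x] Jv[of z] e by linarith
    next
      case False
      define a b where "a = norm x" and "b = norm z"
      have ab: "e / 8 < a" "e / 8 < b" using False by (auto simp: a_def b_def)
      then have ab0: "0 < a" "0 < b" using e by auto
      define x' z' where "x' = (1/a) *\<^sub>R x" and "z' = (1/b) *\<^sub>R z"
      have n: "norm x' = 1" "norm z' = 1" using ab0 by (auto simp: x'_def z'_def a_def b_def)
      have xz': "x = a *\<^sub>R x'" "z = b *\<^sub>R z'" using ab0 by (auto simp: x'_def z'_def)
      have "a *\<^sub>R (x' - z') = (x - z) - (a - b) *\<^sub>R z'"
        by (simp add: xz' algebra_simps)
      then have "norm (a *\<^sub>R (x' - z')) \<le> norm (x - z) + norm ((a - b) *\<^sub>R z')"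
        by (metis norm_triangle_ineq4)
      then have "a * norm (x' - z') \<le> 2 * norm (x - z)"
        using d ab0 n by (simp add: a_def b_def)
      also have "\<dots> < 2 * (\<delta> * e / 16)" using xz \<delta>' by linarith
      also have "\<dots> = e / 8 * \<delta>" by simp
      also have "\<dots> \<le> a * \<delta>" using ab \<delta>(1) by (intro mult_right_mono) auto
      finally have "norm (x' - z') < \<delta>" using ab0 by simp
      from \<delta>(2)[OF n this] have c: "\<bar>J x' v - J z' v\<bar> < e / (2 * R')" .
      have Jx: "J x v = a * J x' v" and Jz: "J z v = b * J z' v"
        using ab0 by (simp_all add: xz' J_scaleR blinfun.scaleR_left)
      have "J x v - J z v = a * (J x' v - J z' v) + (a - b) * J z' v"
        unfolding Jx Jz by (simp add: algebra_simps)
      then have "\<bar>J x v - J z v\<bar> \<le> a * \<bar>J x' v - J z' v\<bar> + \<bar>a - b\<bar> * \<bar>J z' v\<bar>"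
        using ab0 by (metis abs_mult abs_of_pos abs_triangle_ineq)
      moreover have "a * \<bar>J x' v - J z' v\<bar> \<le> R' * (e / (2 * R'))"
        using xz ab0 c by (intro mult_mono) (auto simp: a_def R'_def)
      moreover have "R' * (e / (2 * R')) = e / 2" using R' by simp
      moreover have "\<bar>a - b\<bar> * \<bar>J z' v\<bar> \<le> \<bar>a - b\<bar> * 1"
        using Jv[of z'] n by (intro mult_left_mono) auto
      ultimately show ?thesis using d xz \<delta>' e unfolding a_def b_def by linarith
    qed
  qed
  with \<delta>'(1) that show ?thesis by blast
qed

text \<open>\<open>J\<close> is uniformly continuous on bounded sets from the norm topology to the weak\<open>\<^sup>*\<close>
  topology.\<close>

lemma J_weak_star_uniform:
  fixes x y :: "nat \<Rightarrow> 'a"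
  assumes R: "\<And>n. norm (x n) \<le> R" "\<And>n. norm (y n) \<le> R"
    and lim: "(\<lambda>n. x n - y n) \<longlonglongrightarrow> 0"
  shows "(\<lambda>n. J (x n) v - J (y n) v) \<longlonglongrightarrow> 0"
proof (cases "v = 0")
  case False
  define v' where "v' = (1 / norm v) *\<^sub>R v"
  have v': "norm v' = 1" "v = norm v *\<^sub>R v'" using False by (auto simp: v'_def)
  have "(\<lambda>n. J (x n) v' - J (y n) v') \<longlonglongrightarrow> 0"
  proof (rule LIMSEQ_I)
    fix e :: real assume "0 < e"
    then obtain \<delta> where \<delta>: "0 < \<delta>" "\<And>x z::'a. norm x \<le> R \<Longrightarrow> norm z \<le> R \<Longrightarrow> norm (x - z) < \<delta>
      \<Longrightarrow> \<bar>J x v' - J z v'\<bar> < e"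
      using J_uniform_bounded[OF v'(1)] by metis
    from LIMSEQ_D[OF lim \<delta>(1)] obtain no where "\<forall>n\<ge>no. norm (x n - y n) < \<delta>" by auto
    then have "\<forall>n\<ge>no. norm (J (x n) v' - J (y n) v' - 0) < e"
      using \<delta>(2) R by simp
    then show "\<exists>no. \<forall>n\<ge>no. norm (J (x n) v' - J (y n) v' - 0) < e" ..
  qed
  from tendsto_mult_right_zero[OF this, of "norm v"] show ?thesis
    by (subst (1 2) v'(2)) (simp add: blinfun.scaleR_right right_diff_distrib)
qed simp

lemma J_tendsto:
  fixes x w :: "nat \<Rightarrow> 'a"
  assumes x: "x \<longlonglongrightarrow> x'" and w: "w \<longlonglongrightarrow> w'"
  shows "(\<lambda>n. J (x n) (w n)) \<longlonglongrightarrow> J x' w'"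
proof -
  obtain K where K: "\<And>n. norm (x n) \<le> K"
    using convergent_imp_Bseq[of x] x by (auto simp: convergent_def Bseq_def)
  have "(\<lambda>n. x n - x') \<longlonglongrightarrow> 0" using x by (simp add: LIM_zero)
  then have 1: "(\<lambda>n. J (x n) w' - J x' w') \<longlonglongrightarrow> 0"
    by (rule J_weak_star_uniform[of _ "max K (norm x')", rotated 2]) (auto intro: max.coboundedI1 K)
  have "(\<lambda>n. J (x n) (w n - w')) \<longlonglongrightarrow> 0"
  proof (rule Lim_null_comparison)
    show "\<forall>\<^sub>F n in sequentially. norm (J (x n) (w n - w')) \<le> K * norm (w n - w')"
    proof (rule always_eventually, rule allI)
      fix n
      have "norm (J (x n) (w n - w')) \<le> norm (x n) * norm (w n - w')"
        using norm_blinfun[of "J (x n)" "w n - w'"] by simp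
      also have "\<dots> \<le> K * norm (w n - w')" using K by (intro mult_right_mono) auto
      finally show "norm (J (x n) (w n - w')) \<le> K * norm (w n - w')" .
    qed
    show "(\<lambda>n. K * norm (w n - w')) \<longlonglongrightarrow> 0"
      using w by (intro tendsto_mult_right_zero tendsto_norm_zero LIM_zero)
  qed
  from tendsto_add[OF this 1] have "(\<lambda>n. J (x n) (w n) - J x' w') \<longlonglongrightarrow> 0"
    by (simp add: blinfun.diff_right)
  then show ?thesis by (rule LIM_zero_cancel)
qed

section \<open>The generalized projection\<close>

lemma Q_minimizes:
  fixes D :: "'a set"
  assumes "closed D" "convex D" "D \<noteq> {}"
  shows "Q D u \<in> D \<and> (\<forall>y\<in>D. phi (Q D u) u \<le> phi y u)"
proof -
  obtain z where z: "z \<in> D" "\<And>w. w \<in> D \<Longrightarrow> (norm z)\<^sup>2 / 2 - J u z \<le> (norm w)\<^sup>2 / 2 - J u w"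
    using minimizer_exists[OF assms, of "J u"] by blast
  have phi: "phi w u = 2 * ((norm w)\<^sup>2 / 2 - J u w) + (norm u)\<^sup>2" for w
    by (simp add: phi_def algebra_simps)
  have zmin: "phi z u \<le> phi w u" if "w \<in> D" for w
    using z(2)[OF that] by (simp add: phi)
  show ?thesis
    unfolding Q_def
  proof (rule theI2[where a = z])
    fix x assume x: "x \<in> D \<and> (\<forall>y\<in>D. phi x u \<le> phi y u)"
    have "(1/2) *\<^sub>R z + (1/2) *\<^sub>R x \<in> D"
      using z(1) x by (intro convexD[OF \<open>convex D\<close>]) auto
    then have "phi z u \<le> phi ((1/2) *\<^sub>R (z + x)) u" unfolding scaleR_add_right by (rule zmin)
    also have "\<dots> = phi z u / 2 + phi x u / 2 - midgap z x"
      unfolding phi half_sq_midpoint by (simp add: blinfun.add_right blinfun.scaleR_right field_simps)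
    finally have "midgap z x \<le> 0" using x z(1) by force
    then show "x = z" using midgap_le_0_imp_eq by blast
  qed (use z zmin in auto)
qed

lemma Q_variational:
  fixes D :: "'a set"
  assumes D: "closed D" "convex D" and z: "z \<in> D"
  shows "(J u - J (Q D u)) (z - Q D u) \<le> 0"
proof -
  define p where "p = Q D u"
  have p: "p \<in> D" "\<And>y. y \<in> D \<Longrightarrow> phi p u \<le> phi y u"
    using Q_minimizes[OF D, of u] z unfolding p_def by auto
  define t where "t n = inverse (real (Suc n))" for n
  define q where "q n = p + t n *\<^sub>R (z - p)" for n
  have le: "J u (z - p) \<le> J (q n) (z - p)" for n
  proof -
    have t: "0 < t n" "t n \<le> 1" by (auto simp: t_def field_simps)
    have "(1 - t n) *\<^sub>R p + t n *\<^sub>R z \<in> D"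
      using t p(1) z by (intro convexD[OF D(2)]) auto
    then have "q n \<in> D" by (simp add: q_def algebra_simps)
    then have "phi p u \<le> phi (q n) u" by (rule p)
    then have "J u (q n) - J u p \<le> (norm (q n))\<^sup>2 / 2 - (norm p)\<^sup>2 / 2"
      by (simp add: phi_def field_simps)
    also have "\<dots> \<le> J (q n) (q n) - J (q n) p"
      using half_sq_subgradient[of "q n" p] by (simp add: blinfun.diff_right)
    finally have "J u (q n - p) \<le> J (q n) (q n - p)" by (simp only: blinfun.diff_right)
    moreover have "q n - p = t n *\<^sub>R (z - p)" by (simp add: q_def)
    ultimately have "t n * J u (z - p) \<le> t n * J (q n) (z - p)"
      by (simp only: blinfun.scaleR_right) simp
    then show ?thesis using t by simp
  qed
  have "t \<longlonglongrightarrow> 0" unfolding t_def by (rule LIMSEQ_inverse_real_of_nat)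
  then have "q \<longlonglongrightarrow> p + 0 *\<^sub>R (z - p)" unfolding q_def by (intro tendsto_intros)
  then have "(\<lambda>n. J (q n) (z - p)) \<longlonglongrightarrow> J p (z - p)" by (intro J_tendsto) auto
  then have "J u (z - p) \<le> J p (z - p)"
    by (rule LIMSEQ_le_const) (use le in auto)
  then show ?thesis by (simp add: p_def blinfun.diff_left)
qed

section \<open>Existence of resolvents\<close>

text \<open>The inequality says that \<open>(x, - J a)\<close> is monotonically related to every point of \<open>B\<close>, with the
  excess \<open>(norm x)\<^sup>2 / 2 + (norm a)\<^sup>2 / 2 - J a x\<close>. If \<open>B\<close> is maximal, evaluation at \<open>(x, - J a)\<close> itself
  forces \<open>x = a\<close>.\<close>

lemma monotone_saddle:
  fixes B :: "('a \<times> 'a dual) set"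
  assumes B: "monotone_operator B" and ne: "B \<noteq> {}"
  obtains x a where "\<And>y f. (y, f) \<in> B \<Longrightarrow> (norm x)\<^sup>2 / 2 + (norm a)\<^sup>2 / 2 + f x \<le> J a y + f y"
proof -
  define C where "C = graph_hull B"
  have convC: "convex C" by (simp add: C_def graph_hull_def)
  have BC: "(y, f, f y) \<in> C" if "(y, f) \<in> B" for y f
    unfolding C_def graph_hull_def using that by (intro hull_inc) force
  have C: "b' a + b a' \<le> c + c'" if "(a, b, c) \<in> C" "(a', b', c') \<in> C" for a b c a' b' c'
    using graph_hull_monotone[OF B] that unfolding C_def .
  define g where "g = (\<lambda>(a::'a, b::'a dual, c::real). (norm a)\<^sup>2 / 2 + (norm b)\<^sup>2 / 2 + c)"
  have g_eq: "g (a, b, c) = (norm a)\<^sup>2 / 2 + (norm b)\<^sup>2 / 2 + c" for a b c by (simp add: g_def)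
  have g0: "0 \<le> g w" if "w \<in> C" for w
  proof -
    obtain a b c where w: "w = (a, b, c)" by (cases w)
    have "b a \<le> c" using C[of a b c a b c] that w by simp
    moreover have "- (norm b * norm a) \<le> b a"
      using norm_blinfun[of b a] by simp
    moreover have "0 \<le> (norm a - norm b)\<^sup>2" by simp
    ultimately show ?thesis by (simp add: w g_eq power2_eq_square algebra_simps)
  qed
  define m where "m = Inf (g ` C)"
  have Cne: "C \<noteq> {}" using ne BC by auto
  have bdd: "bdd_below (g ` C)" using g0 by (rule bdd_belowI2)
  have m_le: "m \<le> g w" if "w \<in> C" for w
    unfolding m_def using that bdd by (intro cInf_lower imageI)
  have m0: "0 \<le> m" unfolding m_def using Cne g0 by (intro cINF_greatest)
  \<comment> \<open>The same \<open>t n\<close> serves as step size and, squared, as minimization error: a step that does not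
    improve beyond the error then has slope at least \<open>- t n\<close>.\<close>
  define t where "t n = inverse (real (Suc n))" for n
  have t: "0 < t n" "t n \<le> 1" for n by (auto simp: t_def field_simps)
  have t_mono: "t m \<le> t n" if "n \<le> m" for n m using that by (simp add: t_def field_simps)
  have t_lim: "t \<longlonglongrightarrow> 0" unfolding t_def by (rule LIMSEQ_inverse_real_of_nat)
  have t2: "(t n)\<^sup>2 \<le> t n" for n using t[of n] by (simp add: power2_eq_square)
  have "\<exists>w\<in>C. g w < m + (t n)\<^sup>2" for n
  proof -
    have "Inf (g ` C) < m + (t n)\<^sup>2" using t[of n] by (simp add: m_def)
    then show ?thesis using cInf_lessD[of "g ` C"] Cne by blast
  qed
  then obtain w where w: "\<And>n. w n \<in> C" "\<And>n. g (w n) < m + (t n)\<^sup>2" by metis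
  define a where "a n = fst (w n)" for n
  define b where "b n = fst (snd (w n))" for n
  define c where "c n = snd (snd (w n))" for n
  have w_eq: "w n = (a n, b n, c n)" for n by (simp add: a_def b_def c_def)
  have gw: "(norm (a n))\<^sup>2 / 2 + (norm (b n))\<^sup>2 / 2 + c n < m + (t n)\<^sup>2" for n
    using w(2)[of n] by (simp add: w_eq g_eq)
  have wC: "(a n, b n, c n) \<in> C" for n using w(1)[of n] by (simp add: w_eq)
  obtain R where R: "\<And>n. norm (a n) \<le> R" "\<And>n. norm (b n) \<le> R"
  proof -
    obtain a0 b0 c0 where w0: "(a0, b0, c0) \<in> C" using Cne by auto
    define K where "K = m + 1 + c0 + (norm a0)\<^sup>2 + (norm b0)\<^sup>2"
    have le: "(norm (a n))\<^sup>2 + (norm (b n))\<^sup>2 \<le> 4 * K" for n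
    proof -
      have "b0 (a n) + b n a0 \<le> c n + c0" by (rule C[OF wC w0])
      moreover have "- (norm b0 * norm (a n)) \<le> b0 (a n)" using norm_blinfun[of b0 "a n"] by simp
      moreover have "- (norm (b n) * norm a0) \<le> b n a0" using norm_blinfun[of "b n" a0] by simp
      moreover have "0 \<le> (norm (a n) / 2 - norm b0)\<^sup>2" "0 \<le> (norm (b n) / 2 - norm a0)\<^sup>2" by simp_all
      moreover have "(t n)\<^sup>2 \<le> 1" using t2[of n] t[of n] by linarith
      ultimately show ?thesis using gw[of n] unfolding K_def
        by (simp add: power2_eq_square algebra_simps)
    qed
    have "norm (a n) \<le> sqrt (4 * K)" for n
      by (rule real_le_rsqrt) (use le[of n] zero_le_power2[of "norm (b n)"] in linarith)
    moreover have "norm (b n) \<le> sqrt (4 * K)" for n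
      by (rule real_le_rsqrt) (use le[of n] zero_le_power2[of "norm (a n)"] in linarith)
    ultimately show ?thesis using that by blast
  qed
  have R0: "0 \<le> R" using R(1)[of 0] norm_ge_zero order_trans by blast
  have "Cauchy a"
  proof (rule midgap_Cauchy[OF R(1)])
    fix \<delta> :: real assume "0 < \<delta>"
    then have "\<forall>\<^sub>F n in sequentially. t n < \<delta> / 2"
      using t_lim by (intro order_tendstoD) auto
    then obtain N where N: "\<And>n. N \<le> n \<Longrightarrow> t n < \<delta> / 2" unfolding eventually_sequentially by auto
    have "midgap (a n) (a k) < \<delta>" if "N \<le> n" "n \<le> k" for n k
    proof -
      have "(1/2) *\<^sub>R w n + (1/2) *\<^sub>R w k \<in> C"
        using w(1) by (intro convexD[OF convC]) auto
      from m_le[OF this]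
      have "m \<le> (norm ((1/2) *\<^sub>R (a n + a k)))\<^sup>2 / 2 + (norm ((1/2) *\<^sub>R (b n + b k)))\<^sup>2 / 2 + (c n + c k) / 2"
        by (simp add: w_eq g_eq scaleR_add_right add_divide_distrib)
      then have "midgap (a n) (a k) \<le> (t n)\<^sup>2 + (t k)\<^sup>2"
        using gw[of n] gw[of k] midgap_nonneg[of "b n" "b k"] unfolding half_sq_midpoint add_divide_distrib by linarith
      also have "\<dots> \<le> t n + t n" using t2[of n] t2[of k] t_mono[OF that(2)] by linarith
      finally show ?thesis using N[OF that(1)] by linarith
    qed
    then show "\<exists>N. \<forall>n\<ge>N. \<forall>m\<ge>n. midgap (a n) (a m) < \<delta>" by blast
  qed
  then obtain a' where a': "a \<longlonglongrightarrow> a'" using Cauchy_convergent convergent_def by blast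
  define x where "x n = inv J (b n)" for n
  have Jx: "J (x n) = b n" and nx: "norm (b n) = norm (x n)" for n by (simp_all add: x_def)
  have b_x: "b n (x n) = (norm (x n))\<^sup>2" for n using J_self[of "x n"] by (simp add: Jx)
  have xR: "norm (x n) \<le> R" for n using R(2)[of n] by (simp add: nx)
  \<comment> \<open>First-order optimality in the direction of a point of the hull. The error \<open>e\<close> depends on the
    direction.\<close>
  have star: "\<exists>e. e \<longlonglongrightarrow> 0 \<and> (\<forall>n. (norm (x n))\<^sup>2 / 2 + (norm a')\<^sup>2 / 2 + m \<le> J a' y + f (x n) + \<gamma> + e n)"
    if yC: "(y, f, \<gamma>) \<in> C" for y f \<gamma>
  proof -
    define p where "p n = a n + t n *\<^sub>R (y - a n)" for n
    define q where "q n = b n + t n *\<^sub>R (f - b n)" for n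
    define z where "z n = inv J (q n)" for n
    define e where "e n = (J (p n) (y - a n) - J a' (y - a')) + ((norm (a n))\<^sup>2 / 2 - (norm a')\<^sup>2 / 2)
         + (f - b n) (z n - x n) + t n" for n
    have "(norm (x n))\<^sup>2 / 2 + (norm a')\<^sup>2 / 2 + m \<le> J a' y + f (x n) + \<gamma> + e n" for n
    proof -
      have "(1 - t n) *\<^sub>R w n + t n *\<^sub>R (y, f, \<gamma>) \<in> C"
        using w(1) yC t[of n] by (intro convexD[OF convC]) auto
      moreover have "(1 - t n) *\<^sub>R w n + t n *\<^sub>R (y, f, \<gamma>) = (p n, q n, c n + t n * (\<gamma> - c n))"
        by (simp add: w_eq p_def q_def algebra_simps)
      ultimately have 1: "m \<le> (norm (p n))\<^sup>2 / 2 + (norm (q n))\<^sup>2 / 2 + c n + t n * (\<gamma> - c n)"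
        using m_le by (force simp: g_eq)
      have "a n - p n = - (t n *\<^sub>R (y - a n))" by (simp add: p_def)
      then have "J (p n) (a n - p n) = - (t n * J (p n) (y - a n))"
        by (simp only: blinfun.minus_right blinfun.scaleR_right) simp
      then have 2: "(norm (p n))\<^sup>2 / 2 \<le> (norm (a n))\<^sup>2 / 2 + t n * J (p n) (y - a n)"
        using half_sq_subgradient[of "p n" "a n"] by linarith
      have qz: "q n (z n) = (norm (z n))\<^sup>2" "norm (q n) = norm (z n)"
        using J_self[of "z n"] by (simp_all add: z_def)
      have "b n (z n) \<le> norm (x n) * norm (z n)" using J_le[of "x n" "z n"] by (simp add: Jx)
      moreover have "0 \<le> (norm (x n) - norm (z n))\<^sup>2" by simp
      ultimately have "b n (z n) \<le> (norm (x n))\<^sup>2 / 2 + (norm (z n))\<^sup>2 / 2"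
        by (simp add: power2_eq_square algebra_simps)
      moreover have "q n (z n) = b n (z n) + t n * (f - b n) (z n)"
        by (simp add: q_def blinfun.add_left blinfun.scaleR_left)
      ultimately have 3: "(norm (q n))\<^sup>2 / 2 \<le> (norm (x n))\<^sup>2 / 2 + t n * (f - b n) (z n)"
        unfolding qz(2) using qz(1) by linarith
      have "0 \<le> t n * (J (p n) (y - a n) + (f - b n) (z n) + (\<gamma> - c n) + t n)"
        using 1 2 3 gw[of n] unfolding nx ring_distribs power2_eq_square by linarith
      then have 4: "0 \<le> J (p n) (y - a n) + (f - b n) (z n) + (\<gamma> - c n) + t n"
        using t[of n] by (simp add: zero_le_mult_iff)
      have 5: "m \<le> (norm (a n))\<^sup>2 / 2 + (norm (x n))\<^sup>2 / 2 + c n"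
        using m_le[OF wC[of n]] by (simp add: g_eq nx)
      have "(f - b n) (z n) = (f - b n) (z n - x n) + f (x n) - (norm (x n))\<^sup>2"
        by (simp add: blinfun.diff_left blinfun.diff_right b_x)
      then show ?thesis
        using 4 5 J_self[of a'] by (simp add: e_def blinfun.diff_right)
    qed
    moreover have "e \<longlonglongrightarrow> 0"
    proof -
      have "p \<longlonglongrightarrow> a' + 0 *\<^sub>R (y - a')"
        unfolding p_def by (intro tendsto_intros a' t_lim)
      then have p: "p \<longlonglongrightarrow> a'" by simp
      have 1: "(\<lambda>n. J (p n) (y - a n) - J a' (y - a')) \<longlonglongrightarrow> 0"
        by (intro LIM_zero J_tendsto p tendsto_intros a')
      have 2: "(\<lambda>n. (norm (a n))\<^sup>2 / 2 - (norm a')\<^sup>2 / 2) \<longlonglongrightarrow> 0"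
        by (intro LIM_zero tendsto_intros a') simp
      have fb: "norm (f - b n) \<le> norm f + R" for n
        using norm_triangle_ineq4[of f "b n"] R(2)[of n] by linarith
      have zR: "norm (z n) \<le> 2 * R + norm f" for n
      proof -
        have "norm (q n) \<le> norm (b n) + t n * norm (f - b n)"
          using norm_triangle_ineq[of "b n" "t n *\<^sub>R (f - b n)"] t[of n] by (simp add: q_def)
        also have "t n * norm (f - b n) \<le> 1 * (norm f + R)"
          using t[of n] fb[of n] by (intro mult_mono) auto
        finally show ?thesis using R(2)[of n] by (simp add: z_def)
      qed
      have "(\<lambda>n. J (z n) - J (x n)) \<longlonglongrightarrow> 0"
      proof (rule Lim_null_comparison)
        show "\<forall>\<^sub>F n in sequentially. norm (J (z n) - J (x n)) \<le> t n * (norm f + R)"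
        proof (rule always_eventually, rule allI)
          fix n
          have "norm (J (z n) - J (x n)) = t n * norm (f - b n)"
            using t[of n] by (simp add: z_def Jx q_def)
          also have "\<dots> \<le> t n * (norm f + R)" using fb[of n] t[of n] by (intro mult_left_mono) auto
          finally show "norm (J (z n) - J (x n)) \<le> t n * (norm f + R)" .
        qed
        show "(\<lambda>n. t n * (norm f + R)) \<longlonglongrightarrow> 0" by (rule tendsto_mult_left_zero[OF t_lim])
      qed
      moreover have "norm (x n) \<le> 2 * R + norm f" for n
        using xR[of n] R0 norm_ge_zero[of f] by linarith
      ultimately have zx: "(\<lambda>n. z n - x n) \<longlonglongrightarrow> 0"
        using zR by (intro J_diff_tendsto_0_imp[where R = "2 * R + norm f"]) auto
      have 3: "(\<lambda>n. (f - b n) (z n - x n)) \<longlonglongrightarrow> 0"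
      proof (rule Lim_null_comparison)
        show "\<forall>\<^sub>F n in sequentially. norm ((f - b n) (z n - x n)) \<le> (norm f + R) * norm (z n - x n)"
        proof (rule always_eventually, rule allI)
          fix n
          have "norm ((f - b n) (z n - x n)) \<le> norm (f - b n) * norm (z n - x n)"
            by (rule norm_blinfun)
          also have "\<dots> \<le> (norm f + R) * norm (z n - x n)" using fb[of n] by (intro mult_right_mono) auto
          finally show "norm ((f - b n) (z n - x n)) \<le> (norm f + R) * norm (z n - x n)" .
        qed
        show "(\<lambda>n. (norm f + R) * norm (z n - x n)) \<longlonglongrightarrow> 0"
          by (intro tendsto_mult_right_zero tendsto_norm_zero zx)
      qed
      show ?thesis
        unfolding e_def using tendsto_add[OF tendsto_add[OF tendsto_add[OF 1 2] 3] t_lim] by simp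
    qed
    ultimately show ?thesis by blast
  qed
  \<comment> \<open>The direction \<open>w j\<close> turns optimality into a bound on \<open>phi (x n) (x j)\<close>.\<close>
  have near: "\<exists>e. e \<longlonglongrightarrow> 0 \<and> (\<forall>n. midgap (x n) (x j) \<le> t j + e n)" for j
  proof -
    obtain e where e: "e \<longlonglongrightarrow> 0"
      "\<And>n. (norm (x n))\<^sup>2 / 2 + (norm a')\<^sup>2 / 2 + m \<le> J a' (a j) + b j (x n) + c j + e n"
      using star[OF wC[of j]] by blast
    have "midgap (x n) (x j) \<le> t j + e n" for n
    proof -
      have "(norm a')\<^sup>2 / 2 + (J a' (a j) - (norm a')\<^sup>2) \<le> (norm (a j))\<^sup>2 / 2"
        using half_sq_subgradient[of a' "a j"] by (simp add: blinfun.diff_right)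
      then have "(norm (x n))\<^sup>2 / 2 + (norm (x j))\<^sup>2 / 2 \<le> b j (x n) + (t j)\<^sup>2 + e n"
        using e(2)[of n] gw[of j] unfolding nx by linarith
      then have "phi (x n) (x j) \<le> 2 * t j + 2 * e n"
        using t2[of j] unfolding phi_def Jx by linarith
      then show ?thesis using phi_ge_midgap[of "x n" "x j"] by linarith
    qed
    with e(1) show ?thesis by blast
  qed
  have "Cauchy x"
  proof (rule metric_CauchyI)
    fix \<epsilon> :: real assume "0 < \<epsilon>"
    then have "0 < \<epsilon> / 2" by simp
    then obtain \<delta> where \<delta>: "0 < \<delta>" "\<And>x y::'a. norm x \<le> R \<Longrightarrow> norm y \<le> R \<Longrightarrow> midgap x y < \<delta>
                      \<Longrightarrow> norm (x - y) < \<epsilon> / 2"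
      using uniformly_convex_midgap[OF uc] by metis
    have "\<forall>\<^sub>F j in sequentially. t j < \<delta> / 2"
      using t_lim \<delta>(1) by (intro order_tendstoD) auto
    then obtain j where j: "t j < \<delta> / 2" unfolding eventually_sequentially by auto
    obtain e where e: "e \<longlonglongrightarrow> 0" "\<And>n. midgap (x n) (x j) \<le> t j + e n" using near by blast
    have "\<forall>\<^sub>F n in sequentially. e n < \<delta> / 2"
      using e(1) \<delta>(1) by (intro order_tendstoD) auto
    then obtain N where N: "\<And>n. N \<le> n \<Longrightarrow> e n < \<delta> / 2" unfolding eventually_sequentially by auto
    have near_j: "dist (x n) (x j) < \<epsilon> / 2" if "N \<le> n" for n
      unfolding dist_norm using N[OF that] e(2)[of n] j by (intro \<delta>(2) xR) linarith
    show "\<exists>M. \<forall>m\<ge>M. \<forall>n\<ge>M. dist (x m) (x n) < \<epsilon>"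
      using near_j dist_triangle_half_l by blast
  qed
  then obtain x' where x': "x \<longlonglongrightarrow> x'" using Cauchy_convergent convergent_def by blast
  have "(norm (- x'))\<^sup>2 / 2 + (norm a')\<^sup>2 / 2 + f (- x') \<le> J a' y + f y" if yf: "(y, f) \<in> B" for y f
  proof -
    obtain e where e: "e \<longlonglongrightarrow> 0"
      "\<And>n. (norm (x n))\<^sup>2 / 2 + (norm a')\<^sup>2 / 2 + m \<le> J a' y + f (x n) + f y + e n"
      using star[OF BC[OF yf]] by blast
    have "(norm x')\<^sup>2 / 2 + (norm a')\<^sup>2 / 2 + m \<le> J a' y + f x' + f y + 0"
    proof (rule LIMSEQ_le)
      show "(\<lambda>n. (norm (x n))\<^sup>2 / 2 + (norm a')\<^sup>2 / 2 + m) \<longlonglongrightarrow> (norm x')\<^sup>2 / 2 + (norm a')\<^sup>2 / 2 + m"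
        by (intro tendsto_intros x') simp
      show "(\<lambda>n. J a' y + f (x n) + f y + e n) \<longlonglongrightarrow> J a' y + f x' + f y + 0"
        by (intro tendsto_intros x' e(1))
    qed (use e(2) in auto)
    then show ?thesis using m0 by (simp add: blinfun.minus_right)
  qed
  then show ?thesis using that by blast
qed

text \<open>The saddle inequality is applied to the operator \<open>r A - J x\<close>.\<close>

lemma resolvent_exists:
  fixes A :: "('a \<times> 'a dual) set"
  assumes A: "maximal_monotone_operator A" and r: "0 < r"
  shows "\<exists>z. (z, (1 / r) *\<^sub>R (J x - J z)) \<in> A"
proof -
  define B where "B = (\<lambda>(y, h). (y, r *\<^sub>R h - J x)) ` A"
  have "A \<noteq> {}" using maximal_monotone_memI[OF A, of 0 0] by auto
  then have ne: "B \<noteq> {}" by (simp add: B_def)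
  have "monotone_operator B"
    unfolding monotone_operator_def B_def
  proof clarify
    fix y h y' h' assume "(y, h) \<in> A" "(y', h') \<in> A"
    then have "0 \<le> r * (h - h') (y - y')"
      using maximal_monotone_monotone[OF A] r by simp
    then show "0 \<le> (r *\<^sub>R h - J x - (r *\<^sub>R h' - J x)) (y - y')"
      by (simp add: blinfun.diff_left blinfun.scaleR_left algebra_simps)
  qed
  then obtain z a where z: "\<And>y f. (y, f) \<in> B \<Longrightarrow> (norm z)\<^sup>2 / 2 + (norm a)\<^sup>2 / 2 + f z \<le> J a y + f y"
    using monotone_saddle[OF _ ne] by metis
  have zA: "(norm z)\<^sup>2 / 2 + (norm a)\<^sup>2 / 2 + (r * h z - J x z) \<le> J a y + (r * h y - J x y)"
    if "(y, h) \<in> A" for y h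
  proof -
    have "(y, r *\<^sub>R h - J x) \<in> B" unfolding B_def using that by force
    from z[OF this] show ?thesis by (simp add: blinfun.diff_left blinfun.scaleR_left)
  qed
  have a: "(z, (1 / r) *\<^sub>R (J x - J a)) \<in> A"
  proof (rule maximal_monotone_memI[OF A])
    fix y h assume "(y, h) \<in> A"
    from zA[OF this] have "0 \<le> (J x - J a) (z - y) - r * h (z - y)"
      using phi_nonneg[of z a] by (simp add: phi_def blinfun.diff_left blinfun.diff_right algebra_simps)
    then have "0 \<le> (1 / r) * ((J x - J a) (z - y) - r * h (z - y))" using r by simp
    then show "0 \<le> ((1 / r) *\<^sub>R (J x - J a) - h) (z - y)"
      using r by (simp add: blinfun.diff_left blinfun.scaleR_left right_diff_distrib)
  qed
  from zA[OF a] have "phi z a \<le> 0"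
    using r by (simp add: phi_def blinfun.diff_left blinfun.scaleR_left)
  then have "z = a" by (rule phi_le_0_imp_eq)
  then show ?thesis using a by blast
qed

text \<open>The defining description of \<open>resolvent A r x\<close> has exactly one solution.\<close>

lemma resolvent_mem:
  fixes A :: "('a \<times> 'a dual) set"
  assumes A: "maximal_monotone_operator A" and r: "0 < r"
  shows "(resolvent A r x, (1 / r) *\<^sub>R (J x - J (resolvent A r x))) \<in> A"
proof -
  have iff: "(x, z) \<in> duality_mapping O (op_add duality_mapping (op_scale r A))\<inverse>
      \<longleftrightarrow> (z, (1 / r) *\<^sub>R (J x - J z)) \<in> A" for z
  proof
    assume "(x, z) \<in> duality_mapping O (op_add duality_mapping (op_scale r A))\<inverse>"
    then obtain h where "(z, h) \<in> A" "J x = J z + r *\<^sub>R h"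
      unfolding op_add_def op_scale_def by (auto simp: duality_mapping_iff)
    then show "(z, (1 / r) *\<^sub>R (J x - J z)) \<in> A" using r by simp
  next
    assume z: "(z, (1 / r) *\<^sub>R (J x - J z)) \<in> A"
    then have "(z, r *\<^sub>R ((1 / r) *\<^sub>R (J x - J z))) \<in> op_scale r A"
      unfolding op_scale_def by blast
    then have "(z, J x - J z) \<in> op_scale r A" using r by simp
    then have "(z, J z + (J x - J z)) \<in> op_add duality_mapping (op_scale r A)"
      unfolding op_add_def using duality_mapping_iff[of z "J z"] by blast
    then show "(x, z) \<in> duality_mapping O (op_add duality_mapping (op_scale r A))\<inverse>"
      using duality_mapping_iff[of x "J x"] by auto
  qed
  obtain z where z: "(z, (1 / r) *\<^sub>R (J x - J z)) \<in> A" using resolvent_exists[OF A r] by blast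
  have uniq: "z' = z" if z': "(z', (1 / r) *\<^sub>R (J x - J z')) \<in> A" for z'
  proof -
    have "0 \<le> ((1 / r) *\<^sub>R (J x - J z') - (1 / r) *\<^sub>R (J x - J z)) (z' - z)"
      by (rule maximal_monotone_monotone[OF A z' z])
    also have "\<dots> = - (1 / r) * (J z' - J z) (z' - z)"
      by (simp add: blinfun.diff_left blinfun.scaleR_left diff_divide_distrib)
    finally have "(J z' - J z) (z' - z) \<le> 0" using r by (simp add: divide_le_0_iff)
    then have "phi z' z + phi z z' \<le> 0" by (simp add: phi_add_phi_commute)
    then show ?thesis using phi_nonneg[of z z'] by (intro phi_le_0_imp_eq) linarith
  qed
  have "resolvent A r x = z"
    unfolding resolvent_def iff by (rule the_equality, rule z, rule uniq)
  then show ?thesis using z by simp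
qed

section \<open>Strong convergence of the iteration\<close>

lemma phi_three_point: "phi p w + phi w w' = phi p w' + 2 * (J w - J w') (w - (p::'a))"
  by (simp add: phi_def blinfun.diff_left blinfun.diff_right)

lemma phi_resolvent:
  assumes A: "maximal_monotone_operator A" and r: "0 < r" and p: "(p::'a) \<in> zeros A"
  shows "phi p (resolvent A r x) + phi (resolvent A r x) x \<le> phi p x"
proof -
  let ?y = "resolvent A r x"
  have "0 \<le> ((1 / r) *\<^sub>R (J x - J ?y)) (?y - p)"
    using resolvent_mem[OF A r, of x] p unfolding zeros_iff[OF A] by blast
  then have "0 \<le> (J x - J ?y) (?y - p)"
    using r by (simp add: blinfun.scaleR_left zero_le_divide_iff)
  then show ?thesis
    using phi_three_point[of p ?y x] by (simp add: blinfun.diff_left)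
qed

lemma phi_convex_combination:
  assumes w: "J w = \<alpha> *\<^sub>R J u + (1 - \<alpha>) *\<^sub>R J y" and \<alpha>: "0 \<le> \<alpha>" "\<alpha> \<le> 1"
  shows "phi (p::'a) w \<le> \<alpha> * phi p u + (1 - \<alpha>) * phi p y"
proof -
  have "norm w \<le> \<alpha> * norm u + (1 - \<alpha>) * norm y"
    using norm_triangle_ineq[of "\<alpha> *\<^sub>R J u" "(1 - \<alpha>) *\<^sub>R J y"] \<alpha> norm_J[of w] by (simp add: w)
  then have "(norm w)\<^sup>2 \<le> (\<alpha> * norm u + (1 - \<alpha>) * norm y)\<^sup>2"
    by (intro power_mono) auto
  also have "\<dots> = \<alpha> * (norm u)\<^sup>2 + (1 - \<alpha>) * (norm y)\<^sup>2 - \<alpha> * (1 - \<alpha>) * (norm u - norm y)\<^sup>2"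
    by (simp add: power2_eq_square algebra_simps)
  also have "\<dots> \<le> \<alpha> * (norm u)\<^sup>2 + (1 - \<alpha>) * (norm y)\<^sup>2"
    using \<alpha> by simp
  finally have "(norm w)\<^sup>2 \<le> \<alpha> * (norm u)\<^sup>2 + (1 - \<alpha>) * (norm y)\<^sup>2" .
  moreover have "J w p = \<alpha> * J u p + (1 - \<alpha>) * J y p"
    by (simp add: w blinfun.add_left blinfun.scaleR_left)
  ultimately show ?thesis unfolding phi_def by (simp add: algebra_simps)
qed

text \<open>The three-point identity compares \<open>w\<close> with the point obtained when the anchor \<open>u\<close> is replaced
  by \<open>p\<close>, whose distance to \<open>p\<close> carries no anchor term since \<open>phi p p = 0\<close>.\<close>

lemma phi_anchored_step:
  assumes w: "J w = \<alpha> *\<^sub>R J u + (1 - \<alpha>) *\<^sub>R J y" and \<alpha>: "0 \<le> \<alpha>" "\<alpha> \<le> 1"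
  shows "phi (p::'a) w \<le> (1 - \<alpha>) * phi p y + \<alpha> * (2 * (J u - J p) (w - p))"
proof -
  define w' :: 'a where "w' = inv J (\<alpha> *\<^sub>R J p + (1 - \<alpha>) *\<^sub>R J y)"
  have w': "J w' = \<alpha> *\<^sub>R J p + (1 - \<alpha>) *\<^sub>R J y" by (simp add: w'_def)
  have "phi p w' \<le> (1 - \<alpha>) * phi p y"
    using phi_convex_combination[OF w' \<alpha>, of p] by (simp add: phi_def)
  moreover have "J w - J w' = \<alpha> *\<^sub>R (J u - J p)" by (simp add: w w' algebra_simps)
  ultimately show ?thesis
    using phi_three_point[of p w w'] phi_nonneg[of w w'] by (simp add: blinfun.scaleR_left)
qed

lemma norm_le_of_phi_le:
  assumes "phi p w \<le> K"
  shows "norm (w::'a) \<le> norm p + sqrt K"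
proof -
  have "norm w - norm p \<le> sqrt K"
    using phi_ge_norm_diff[of p w] assms by (intro real_le_rsqrt) (simp add: power2_commute)
  then show ?thesis by simp
qed

text \<open>Every bounded sequence has a point that behaves like a weak cluster point: it satisfies
  each linear inequality that holds eventually along the sequence.\<close>

lemma weak_cluster_point_exists:
  fixes y :: "nat \<Rightarrow> 'a"
  assumes R: "\<And>n. norm (y n) \<le> R"
  obtains z where "\<And>(g::'a dual) c. (\<forall>\<^sub>F n in sequentially. c \<le> g (y n)) \<Longrightarrow> c \<le> g z"
proof -
  \<comment> \<open>A linear inequality that holds from index \<open>N\<close> on holds on all of \<open>D N\<close>.\<close>
  define D where "D n = closure (convex hull (y ` {n..}))" for n :: nat
  have yD: "y n \<in> D n" for n
    unfolding D_def by (intro closure_subset[THEN subsetD] hull_inc) simp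
  have "\<exists>z. (\<forall>n. z \<in> D n) \<and> (\<forall>w. (\<forall>n. w \<in> D n)
      \<longrightarrow> (norm z)\<^sup>2 / 2 - (0::'a dual) z \<le> (norm w)\<^sup>2 / 2 - (0::'a dual) w)"
  proof (rule nested_minimizer)
    show "closed (D n)" "convex (D n)" for n by (simp_all add: D_def convex_closure)
    show "D m \<subseteq> D n" if "n \<le> m" for n m
      unfolding D_def using that by (intro closure_mono hull_mono image_mono) auto
    show "\<exists>w\<in>D n. (norm w)\<^sup>2 / 2 - (0::'a dual) w \<le> R\<^sup>2 / 2" for n
      using yD[of n] power_mono[OF R[of n] norm_ge_zero, of 2] by (intro bexI[of _ "y n"]) auto
  qed
  then obtain z where z: "\<And>n. z \<in> D n" by blast
  have "c \<le> g z" if ev: "\<forall>\<^sub>F n in sequentially. c \<le> g (y n)" for g :: "'a dual" and c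
  proof -
    obtain N where N: "\<And>n. N \<le> n \<Longrightarrow> c \<le> g (y n)"
      using ev unfolding eventually_sequentially by auto
    have "convex (blinfun_apply g -` {c..})"
      by (intro convex_linear_vimage bounded_linear.linear blinfun.bounded_linear_right) simp
    moreover have "closed {w. c \<le> g w}" by (intro closed_Collect_le continuous_intros)
    moreover have "blinfun_apply g -` {c..} = {w. c \<le> g w}" by auto
    ultimately have "D N \<subseteq> {w. c \<le> g w}"
      unfolding D_def using N by (intro closure_minimal hull_minimal) auto
    then show ?thesis using z[of N] by auto
  qed
  then show ?thesis using that by blast
qed

text \<open>Here \<open>J (x k) - J (y k)\<close> tends to \<open>0\<close> only weakly-star, so its pairing with the moving point
  \<open>y k\<close> is computed through \<open>phi\<close>; the lower bound on \<open>r\<close> absorbs the factor \<open>1 / r k\<close>.\<close>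

lemma weak_cluster_point_zero:
  fixes x y :: "nat \<Rightarrow> 'a"
  assumes A: "maximal_monotone_operator A"
    and mem: "\<And>k. (y k, (1 / r k) *\<^sub>R (J (x k) - J (y k))) \<in> A"
    and r: "\<And>k. c \<le> r k" and c: "0 < c"
    and R: "\<And>k. norm (x k) \<le> R" "\<And>k. norm (y k) \<le> R"
    and lim: "(\<lambda>k. phi (y k) (x k)) \<longlonglongrightarrow> 0"
    and z: "\<And>(g::'a dual) c. (\<forall>\<^sub>F n in sequentially. c \<le> g (y n)) \<Longrightarrow> c \<le> g z"
  shows "z \<in> zeros A"
  unfolding zeros_iff[OF A]
proof clarify
  fix v h assume vh: "(v, h) \<in> A"
  have R0: "0 \<le> R" using R(1)[of 0] norm_ge_zero order_trans by blast
  have yx: "(\<lambda>k. y k - x k) \<longlonglongrightarrow> 0" by (rule phi_tendsto_0[OF R(2,1) lim])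
  then have "(\<lambda>k. J (y k) v - J (x k) v) \<longlonglongrightarrow> 0"
    by (rule J_weak_star_uniform[OF R(2,1)])
  moreover have "(\<lambda>k. (norm (x k))\<^sup>2 - (norm (y k))\<^sup>2) \<longlonglongrightarrow> 0"
  proof (rule Lim_null_comparison)
    show "\<forall>\<^sub>F k in sequentially. norm ((norm (x k))\<^sup>2 - (norm (y k))\<^sup>2) \<le> norm (y k - x k) * (2 * R)"
    proof (rule always_eventually, rule allI)
      fix k
      have "(norm (x k))\<^sup>2 - (norm (y k))\<^sup>2 = (norm (x k) - norm (y k)) * (norm (x k) + norm (y k))"
        by (simp add: power2_eq_square algebra_simps)
      then have "norm ((norm (x k))\<^sup>2 - (norm (y k))\<^sup>2) = \<bar>norm (x k) - norm (y k)\<bar> * (norm (x k) + norm (y k))"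
        by (simp add: abs_mult)
      also have "\<dots> \<le> norm (y k - x k) * (2 * R)"
        using norm_triangle_ineq3[of "x k" "y k"] R[of k]
        by (intro mult_mono) (auto simp: norm_minus_commute)
      finally show "norm ((norm (x k))\<^sup>2 - (norm (y k))\<^sup>2) \<le> norm (y k - x k) * (2 * R)" .
    qed
    show "(\<lambda>k. norm (y k - x k) * (2 * R)) \<longlonglongrightarrow> 0"
      by (intro tendsto_mult_left_zero tendsto_norm_zero yx)
  qed
  ultimately have "(\<lambda>k. (J (y k) v - J (x k) v) + (((norm (x k))\<^sup>2 - (norm (y k))\<^sup>2) - phi (y k) (x k)) / 2)
      \<longlonglongrightarrow> 0 + (0 - 0) / 2"
    using lim by (intro tendsto_intros) auto
  moreover have "(J (y k) v - J (x k) v) + (((norm (x k))\<^sup>2 - (norm (y k))\<^sup>2) - phi (y k) (x k)) / 2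
      = (J (x k) - J (y k)) (y k - v)" for k
    by (simp add: phi_def blinfun.diff_left blinfun.diff_right field_simps)
  ultimately have d: "(\<lambda>k. (J (x k) - J (y k)) (y k - v)) \<longlonglongrightarrow> 0" by simp
  have "h z \<le> h v + e" if e: "0 < e" for e :: real
  proof -
    have "0 < c * e" using c e by simp
    then have "\<forall>\<^sub>F k in sequentially. (J (x k) - J (y k)) (y k - v) < c * e"
      using d by (intro order_tendstoD) auto
    then have "\<forall>\<^sub>F k in sequentially. - h v - e \<le> (- h) (y k)"
    proof eventually_elim
      case (elim k)
      have rk: "0 < r k" using r[of k] c by linarith
      have "0 \<le> ((1 / r k) *\<^sub>R (J (x k) - J (y k)) - h) (y k - v)"
        by (rule maximal_monotone_monotone[OF A mem vh])
      then have 1: "h (y k - v) \<le> (1 / r k) * (J (x k) - J (y k)) (y k - v)"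
        by (simp add: blinfun.diff_left blinfun.scaleR_left)
      have "c * e \<le> r k * e" using r[of k] e by (intro mult_right_mono) auto
      then have "(J (x k) - J (y k)) (y k - v) \<le> e * r k"
        using elim unfolding mult.commute[of e] by linarith
      then have "(1 / r k) * (J (x k) - J (y k)) (y k - v) \<le> e"
        using rk by (simp add: pos_divide_le_eq)
      then show ?case using 1 by (simp add: blinfun.diff_right blinfun.minus_left)
    qed
    then have "- h v - e \<le> (- h) z" by (rule z)
    then show ?thesis by (simp add: blinfun.minus_left)
  qed
  then have "h z \<le> h v" by (rule field_le_epsilon)
  then show "0 \<le> h (v - z)" by (simp add: blinfun.diff_right)
qed

end

text \<open>The recursion \<open>s\<^sub>n\<^sub>+\<^sub>1 \<le> (1 - \<alpha>\<^sub>n) s\<^sub>n + \<alpha>\<^sub>n \<delta>\<close> gives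
  \<open>s\<^sub>n\<^sub>+\<^sub>1 - \<delta> \<le> (1 - \<alpha>\<^sub>n) (s\<^sub>n - \<delta>)\<close>, and the products of the factors \<open>1 - \<alpha>\<^sub>n \<le> exp (- \<alpha>\<^sub>n)\<close>
  tend to \<open>0\<close> because the weights have a divergent sum.\<close>

lemma contraction_divergent_sum_tendsto_0:
  fixes s \<alpha> :: "nat \<Rightarrow> real"
  assumes s0: "\<And>n. 0 \<le> s n" and \<alpha>: "\<And>n. 1 \<le> n \<Longrightarrow> 0 < \<alpha> n \<and> \<alpha> n \<le> 1"
    and div: "filterlim (\<lambda>N. \<Sum>n=1..N. \<alpha> n) at_top sequentially"
    and step: "\<And>\<delta>. 0 < \<delta> \<Longrightarrow> \<exists>N\<ge>1. \<forall>n\<ge>N. s (Suc n) \<le> (1 - \<alpha> n) * s n + \<alpha> n * \<delta>"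
  shows "s \<longlonglongrightarrow> 0"
proof (rule LIMSEQ_I)
  fix e :: real assume e: "0 < e"
  obtain N where N: "1 \<le> N" "\<And>n. N \<le> n \<Longrightarrow> s (Suc n) \<le> (1 - \<alpha> n) * s n + \<alpha> n * (e / 2)"
    using step[of "e / 2"] e by auto
  define S where "S n = (\<Sum>k=1..n. \<alpha> k)" for n
  define M where "M = max 0 (s N - e / 2)"
  have contr: "s (Suc n) - e / 2 \<le> (1 - \<alpha> n) * (s n - e / 2)" if "N \<le> n" for n
  proof -
    have "(1 - \<alpha> n) * (s n - e / 2) = (1 - \<alpha> n) * s n + \<alpha> n * (e / 2) - e / 2"
      by (simp add: field_simps)
    then show ?thesis using N(2)[OF that] by linarith
  qed
  have bound: "s (Suc n) - e / 2 \<le> M * exp (S N - S n)" if "N \<le> n" for n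
    using that
  proof (induction n rule: dec_induct)
    case base
    have "s (Suc N) - e / 2 \<le> (1 - \<alpha> N) * (s N - e / 2)" by (rule contr) simp
    also have "\<dots> \<le> (1 - \<alpha> N) * M" using \<alpha>[OF N(1)] by (intro mult_left_mono) (auto simp: M_def)
    also have "\<dots> \<le> 1 * M" using \<alpha>[OF N(1)] by (intro mult_right_mono) (auto simp: M_def)
    finally show ?case by simp
  next
    case (step n)
    have a: "0 < \<alpha> (Suc n)" "\<alpha> (Suc n) \<le> 1" using \<alpha>[of "Suc n"] by auto
    have "s (Suc (Suc n)) - e / 2 \<le> (1 - \<alpha> (Suc n)) * (s (Suc n) - e / 2)"
      using step by (intro contr) simp
    also have "\<dots> \<le> (1 - \<alpha> (Suc n)) * (M * exp (S N - S n))"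
      using step a by (intro mult_left_mono) auto
    also have "\<dots> \<le> exp (- \<alpha> (Suc n)) * (M * exp (S N - S n))"
      using exp_ge_add_one_self[of "- \<alpha> (Suc n)"] by (intro mult_right_mono) (auto simp: M_def)
    also have "\<dots> = M * exp (S N - S (Suc n))"
      by (simp add: S_def exp_diff exp_add exp_minus field_simps)
    finally show ?case .
  qed
  have "filterlim (\<lambda>n. S n - S N) at_top sequentially"
    using filterlim_tendsto_add_at_top[OF tendsto_const div, of "- S N"] by (simp add: S_def)
  then have "filterlim (\<lambda>n. - (S n - S N)) at_bot sequentially"
    by (simp add: filterlim_uminus_at_top)
  then have "filterlim (\<lambda>n. S N - S n) at_bot sequentially" by simp
  then have "(\<lambda>n. exp (S N - S n)) \<longlonglongrightarrow> 0"
    by (rule filterlim_compose[OF exp_at_bot])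
  then have "(\<lambda>n. M * exp (S N - S n)) \<longlonglongrightarrow> 0" by (rule tendsto_mult_right_zero)
  then have "\<forall>\<^sub>F n in sequentially. M * exp (S N - S n) < e / 2"
    using e by (intro order_tendstoD) auto
  then obtain N' where N': "\<And>n. N' \<le> n \<Longrightarrow> M * exp (S N - S n) < e / 2"
    unfolding eventually_sequentially by auto
  show "\<exists>no. \<forall>n\<ge>no. norm (s n - 0) < e"
  proof (intro exI allI impI)
    fix n assume n: "Suc (max N N') \<le> n"
    then obtain k where k: "n = Suc k" "N \<le> k" "N' \<le> k" by (cases n) auto
    then show "norm (s n - 0) < e" using bound[of k] N'[of k] s0[of n] by simp
  qed
qed

context smooth_uniformly_convex
begin

lemma iteration_tendsto:
  fixes A :: "('a \<times> 'a dual) set" and \<alpha> r :: "nat \<Rightarrow> real" and u :: 'a and x :: "nat \<Rightarrow> 'a"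
  assumes A: "maximal_monotone_operator A"
    and \<alpha>: "\<And>n. n \<ge> 1 \<Longrightarrow> 0 < \<alpha> n \<and> \<alpha> n \<le> 1"
    and c: "0 < c" and r: "\<And>n. n \<ge> 1 \<Longrightarrow> c \<le> r n"
    and ne: "zeros A \<noteq> {}"
    and lim: "\<alpha> \<longlonglongrightarrow> 0"
    and div: "filterlim (\<lambda>N. \<Sum>n=1..N. \<alpha> n) at_top sequentially"
    and x: "\<And>n. n \<ge> 1 \<Longrightarrow>
           x (Suc n) = inv J (\<alpha> n *\<^sub>R J u + (1 - \<alpha> n) *\<^sub>R J (resolvent A (r n) (x n)))"
  shows "x \<longlonglongrightarrow> Q (zeros A) u"
proof -
  define p where "p = Q (zeros A) u"
  note cz = closed_zeros[OF A] convex_zeros[OF A]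
  have p: "p \<in> zeros A" using Q_minimizes[OF cz ne] by (simp add: p_def)
  define y where "y n = resolvent A (r n) (x n)" for n
  define s where "s n = phi p (x n)" for n
  have s0: "0 \<le> s n" for n by (simp add: s_def phi_nonneg)
  have r0: "0 < r n" if "n \<ge> 1" for n using r[OF that] c by linarith
  have Jx: "J (x (Suc n)) = \<alpha> n *\<^sub>R J u + (1 - \<alpha> n) *\<^sub>R J (y n)" if "n \<ge> 1" for n
    using x[OF that] by (simp add: y_def)
  have y: "phi p (y n) + phi (y n) (x n) \<le> s n" if "n \<ge> 1" for n
    unfolding y_def s_def by (rule phi_resolvent[OF A r0[OF that] p])
  have ys: "phi p (y n) \<le> s n" if "n \<ge> 1" for n using y[OF that] phi_nonneg[of "y n" "x n"] by linarith
  have s_Suc: "s (Suc n) \<le> \<alpha> n * phi p u + (1 - \<alpha> n) * phi p (y n)" if "n \<ge> 1" for n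
    unfolding s_def using \<alpha>[OF that] by (intro phi_convex_combination Jx that) auto
  \<comment> \<open>By convexity \<open>s\<close> never exceeds this value, so the iterates and their resolvents stay
    bounded.\<close>
  define K where "K = max (phi p u) (s 1)"
  have K0: "0 \<le> K" using s0[of 1] by (simp add: K_def)
  have sK: "s n \<le> K" if "n \<ge> 1" for n
    using that
  proof (induction n rule: dec_induct)
    case base
    show ?case by (simp add: K_def)
  next
    case (step n)
    have a: "0 \<le> \<alpha> n" "0 \<le> 1 - \<alpha> n" using \<alpha>[of n] step by auto
    have "s (Suc n) \<le> \<alpha> n * phi p u + (1 - \<alpha> n) * phi p (y n)"
      using step by (intro s_Suc) simp
    also have "\<dots> \<le> \<alpha> n * K + (1 - \<alpha> n) * K"
      using a ys[of n] step by (intro add_mono mult_left_mono) (auto simp: K_def)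
    finally show ?case by (simp add: algebra_simps)
  qed
  define R where "R = norm p + sqrt K"
  have xR: "norm (x n) \<le> R" if "n \<ge> 1" for n
    unfolding R_def using sK[OF that] by (intro norm_le_of_phi_le) (simp add: s_def)
  have yR: "norm (y n) \<le> R" if "n \<ge> 1" for n
    unfolding R_def using sK[OF that] ys[OF that] by (intro norm_le_of_phi_le) simp
  define \<tau> where "\<tau> n = 2 * (J u - J p) (x (Suc n) - p)" for n
  \<comment> \<open>Unless \<open>s\<close> drops by a definite amount, \<open>\<tau>\<close> is almost nonpositive. Along a sequence of
    counterexamples \<open>phi (y n) (x n)\<close> tends to \<open>0\<close>, so weak cluster points of \<open>y\<close> are zeros of \<open>A\<close>,
    where the variational inequality of the projection applies.\<close>
  have key: "\<exists>\<eta>>0. \<exists>N. \<forall>n\<ge>N. 1 \<le> n \<longrightarrow> s n - \<eta> < s (Suc n) \<longrightarrow> \<tau> n \<le> \<delta>" if \<delta>: "0 < \<delta>" for \<delta>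
  proof (rule ccontr)
    assume "\<not> ?thesis"
    then have "\<exists>n\<ge>k. 1 \<le> n \<and> s n - inverse (real (Suc k)) < s (Suc n) \<and> \<delta> < \<tau> n" for k :: nat
      by (metis inverse_positive_iff_positive not_le of_nat_0_less_iff zero_less_Suc)
    then obtain \<nu> where \<nu>: "\<And>k. k \<le> \<nu> k" "\<And>k. 1 \<le> \<nu> k"
        "\<And>k. s (\<nu> k) - inverse (real (Suc k)) < s (Suc (\<nu> k))" "\<And>k. \<delta> < \<tau> (\<nu> k)"
      by metis
    have "filterlim \<nu> at_top sequentially"
      by (rule filterlim_at_top_mono[OF filterlim_ident]) (simp add: \<nu>(1))
    then have \<alpha>\<nu>: "(\<lambda>k. \<alpha> (\<nu> k)) \<longlonglongrightarrow> 0" by (rule filterlim_compose[OF lim])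
    have yx: "(\<lambda>k. phi (y (\<nu> k)) (x (\<nu> k))) \<longlonglongrightarrow> 0"
    proof (rule tendsto_sandwich[OF _ _ tendsto_const])
      show "\<forall>\<^sub>F k in sequentially. phi (y (\<nu> k)) (x (\<nu> k)) \<le> \<alpha> (\<nu> k) * phi p u + inverse (real (Suc k))"
      proof (rule always_eventually, rule allI)
        fix k
        have "(1 - \<alpha> (\<nu> k)) * phi p (y (\<nu> k)) \<le> 1 * phi p (y (\<nu> k))"
          using \<alpha>[OF \<nu>(2)[of k]] phi_nonneg by (intro mult_right_mono) auto
        then show "phi (y (\<nu> k)) (x (\<nu> k)) \<le> \<alpha> (\<nu> k) * phi p u + inverse (real (Suc k))"
          using s_Suc[OF \<nu>(2)[of k]] y[OF \<nu>(2)[of k]] \<nu>(3)[of k] by linarith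
      qed
      show "(\<lambda>k. \<alpha> (\<nu> k) * phi p u + inverse (real (Suc k))) \<longlonglongrightarrow> 0"
        using tendsto_add[OF tendsto_mult_left_zero[OF \<alpha>\<nu>] LIMSEQ_inverse_real_of_nat] by simp
    qed (auto simp: phi_nonneg)
    obtain z where z: "\<And>(g::'a dual) c. (\<forall>\<^sub>F k in sequentially. c \<le> g (y (\<nu> k))) \<Longrightarrow> c \<le> g z"
      using weak_cluster_point_exists[of "\<lambda>k. y (\<nu> k)" R] yR[OF \<nu>(2)] by blast
    have "z \<in> zeros A"
    proof (rule weak_cluster_point_zero[OF A _ _ c _ _ yx z])
      show "(y (\<nu> k), (1 / r (\<nu> k)) *\<^sub>R (J (x (\<nu> k)) - J (y (\<nu> k)))) \<in> A" for k
        unfolding y_def by (rule resolvent_mem[OF A r0[OF \<nu>(2)]])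
    qed (use r \<nu>(2) xR yR in auto)
    then have z_le: "(J u - J p) (z - p) \<le> 0"
      unfolding p_def by (rule Q_variational[OF cz])
    have "(\<lambda>k. J (x (Suc (\<nu> k))) - J (y (\<nu> k))) \<longlonglongrightarrow> 0"
    proof (rule Lim_null_comparison)
      show "\<forall>\<^sub>F k in sequentially. norm (J (x (Suc (\<nu> k))) - J (y (\<nu> k))) \<le> \<alpha> (\<nu> k) * (norm u + R)"
      proof (rule always_eventually, rule allI)
        fix k
        have "J (x (Suc (\<nu> k))) - J (y (\<nu> k)) = \<alpha> (\<nu> k) *\<^sub>R (J u - J (y (\<nu> k)))"
          by (simp add: Jx[OF \<nu>(2)] algebra_simps)
        then have "norm (J (x (Suc (\<nu> k))) - J (y (\<nu> k))) = \<alpha> (\<nu> k) * norm (J u - J (y (\<nu> k)))"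
          using \<alpha>[OF \<nu>(2)[of k]] by simp
        also have "\<dots> \<le> \<alpha> (\<nu> k) * (norm u + R)"
          using norm_triangle_ineq4[of "J u" "J (y (\<nu> k))"] yR[OF \<nu>(2)[of k]] \<alpha>[OF \<nu>(2)[of k]]
          by (intro mult_left_mono) auto
        finally show "norm (J (x (Suc (\<nu> k))) - J (y (\<nu> k))) \<le> \<alpha> (\<nu> k) * (norm u + R)" .
      qed
      show "(\<lambda>k. \<alpha> (\<nu> k) * (norm u + R)) \<longlonglongrightarrow> 0" by (rule tendsto_mult_left_zero[OF \<alpha>\<nu>])
    qed
    then have "(\<lambda>k. x (Suc (\<nu> k)) - y (\<nu> k)) \<longlonglongrightarrow> 0"
      by (rule J_diff_tendsto_0_imp[rotated 2]) (use xR yR \<nu>(2) in auto)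
    then have "(\<lambda>k. (J u - J p) (x (Suc (\<nu> k)) - y (\<nu> k))) \<longlonglongrightarrow> (J u - J p) 0"
      by (intro tendsto_intros)
    then have "\<forall>\<^sub>F k in sequentially. (J u - J p) (x (Suc (\<nu> k)) - y (\<nu> k)) < \<delta> / 4"
      using \<delta> by (intro order_tendstoD) (auto simp: blinfun.zero_right)
    then have "\<forall>\<^sub>F k in sequentially. (J u - J p) p + \<delta> / 4 \<le> (J u - J p) (y (\<nu> k))"
    proof eventually_elim
      case (elim k)
      then show ?case using \<nu>(4)[of k] unfolding \<tau>_def blinfun.diff_right right_diff_distrib by linarith
    qed
    then have "(J u - J p) p + \<delta> / 4 \<le> (J u - J p) z" by (rule z)
    with z_le \<delta> show False unfolding blinfun.diff_right by linarith
  qed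
  have "s \<longlonglongrightarrow> 0"
  proof (rule contraction_divergent_sum_tendsto_0[OF s0 \<alpha> div])
    fix \<delta> :: real assume \<delta>: "0 < \<delta>"
    obtain \<eta> N where \<eta>: "0 < \<eta>"
      and N: "\<And>n. N \<le> n \<Longrightarrow> 1 \<le> n \<Longrightarrow> s n - \<eta> < s (Suc n) \<Longrightarrow> \<tau> n \<le> \<delta>"
      using key[OF \<delta>] by blast
    have "(\<lambda>n. \<alpha> n * K) \<longlonglongrightarrow> 0" by (rule tendsto_mult_left_zero[OF lim])
    then have "\<forall>\<^sub>F n in sequentially. \<alpha> n * K < \<eta>"
      using \<eta> by (intro order_tendstoD) auto
    then obtain N' where N': "\<And>n. N' \<le> n \<Longrightarrow> \<alpha> n * K < \<eta>"
      unfolding eventually_sequentially by auto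
    have "s (Suc n) \<le> (1 - \<alpha> n) * s n + \<alpha> n * \<delta>" if n: "max 1 (max N N') \<le> n" for n
    proof -
      have n1: "1 \<le> n" and "N \<le> n" "N' \<le> n" using n by auto
      have a: "0 < \<alpha> n" "\<alpha> n \<le> 1" using \<alpha>[OF n1] by auto
      show ?thesis
      \<comment> \<open>A drop by \<open>\<eta>\<close> exceeds \<open>\<alpha> n * s n\<close>, so the recursion holds in both cases.\<close>
      proof (cases "s n - \<eta> < s (Suc n)")
        case True
        have "s (Suc n) \<le> (1 - \<alpha> n) * phi p (y n) + \<alpha> n * \<tau> n"
          unfolding s_def \<tau>_def using a by (intro phi_anchored_step Jx n1) auto
        also have "\<dots> \<le> (1 - \<alpha> n) * s n + \<alpha> n * \<delta>"
          using a ys[OF n1] N[OF \<open>N \<le> n\<close> n1 True] by (intro add_mono mult_left_mono) auto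
        finally show ?thesis .
      next
        case False
        have "\<alpha> n * s n \<le> \<alpha> n * K" using a sK[OF n1] by (intro mult_left_mono) auto
        moreover have "0 \<le> \<alpha> n * \<delta>" using a \<delta> by simp
        ultimately show ?thesis using False N'[OF \<open>N' \<le> n\<close>] by (simp add: algebra_simps)
      qed
    qed
    then show "\<exists>N\<ge>1. \<forall>n\<ge>N. s (Suc n) \<le> (1 - \<alpha> n) * s n + \<alpha> n * \<delta>"
      by (intro exI[of _ "max 1 (max N N')"]) auto
  qed
  then have "(\<lambda>n. phi p (x (Suc n))) \<longlonglongrightarrow> 0" unfolding s_def by (rule LIMSEQ_Suc)
  then have "(\<lambda>n. p - x (Suc n)) \<longlonglongrightarrow> 0"
    by (rule phi_tendsto_0[where R = "max (norm p) R", rotated 2]) (simp_all add: xR le_max_iff_disj)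
  from tendsto_diff[OF tendsto_const[of p] this] have "(\<lambda>n. x (Suc n)) \<longlonglongrightarrow> p" by simp
  then show ?thesis unfolding p_def by (rule LIMSEQ_imp_Suc)
qed

end

theorem theorem5p2:
  fixes A :: "('a::banach \<times> 'a dual) set"
    and \<alpha> r :: "nat \<Rightarrow> real"
    and u :: 'a
    and x :: "nat \<Rightarrow> 'a"
  assumes "uniformly_convex_space TYPE('a)"
    and "uniformly_gateaux_differentiable_norm TYPE('a)"
    and "maximal_monotone_operator A"
    and "\<And>n. n \<ge> 1 \<Longrightarrow> 0 < \<alpha> n \<and> \<alpha> n \<le> 1"
    and "\<And>n. n \<ge> 1 \<Longrightarrow> 0 < r n"
    and "zeros A \<noteq> {}"
    and "\<alpha> \<longlonglongrightarrow> 0"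
    and "filterlim (\<lambda>N. \<Sum>n=1..N. \<alpha> n) at_top sequentially"
    and "(INF n\<in>{1..}. r n) > 0"
    and "\<And>n. n \<ge> 1 \<Longrightarrow>
           x (Suc n) = inv J (\<alpha> n *\<^sub>R J u + (1 - \<alpha> n) *\<^sub>R J (resolvent A (r n) (x n)))"
  shows "x \<longlonglongrightarrow> Q (zeros A) u"
proof -
  interpret smooth_uniformly_convex "TYPE('a)"
    by unfold_locales (fact assms(1,2))+
  have "(INF n\<in>{1..}. r n) \<le> r n" if "n \<ge> 1" for n
    using that assms(5) by (intro cINF_lower bdd_belowI2[where m = 0]) (auto intro: less_imp_le)
  then show ?thesis
    using assms(3,4,6-10) by (intro iteration_tendsto) auto
qed

end
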